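(* Let $\mathfrak{g}$ be a seven-dimensional real Lie algebra endowed with a closed $\mathrm{G}_2$-structure $\varphi$. Assume that the center $\mathfrak{z}(\mathfrak{g})$ of $\mathfrak{g}$ is not trivial, consider a non-zero vector $z\in\mathfrak{z}(\mathfrak{g})$, and let $\theta\in\mathfrak{g}^*$ be a dual 1-form of $z$, i.e. $\theta(z)=1$. Then there exist a six-dimensional Lie algebra $\mathfrak{h}$ and a closed 2-form $\omega_0$ on $\mathfrak{h}$ such that $\mathfrak{g}=\mathfrak{h}\oplus\mathbb{R}z$ is the central extension of $(\mathfrak{h},\omega_0)$ (with $\theta|_{\mathfrak{h}}=0$), and the closed $\mathrm{G}_2$-structure can be written as \[ \varphi=\widetilde{\omega}\wedge\theta+\rho, \] where $\rho$ is a definite 3-form on $\mathfrak{h}$, $\widetilde{\omega}$ is a symplectic form on $\mathfrak{h}$ that is taming for the almost complex structure $J_\rho$ induced by $\rho$ and one of the two orientations of $\mathfrak{h}$, and $d\rho=-\widetilde{\omega}\wedge\omega_0$.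
   Context: $d$ denotes the Chevalley-Eilenberg differential, with $d\alpha(x,y)=-\alpha([x,y])$ for 1-forms $\alpha$. A symplectic form on a Lie algebra is a closed non-degenerate 2-form. A 3-form $\rho$ on a six-dimensional vector space $V$ is definite if $\iota_v\rho$ has rank four for each non-zero $v\in V$. Given an orientation $\Omega\in\Lambda^6V^*$, define $S_\rho\in\mathrm{End}(V)$ by $\iota_v\rho\wedge\rho\wedge\eta=\eta(S_\rho(v))\,\Omega$ for all $\eta\in V^*$; then $S_\rho^2=P(\rho)\mathrm{Id}_V$ with $P(\rho)<0$ when $\rho$ is definite, and the induced complex structure is $J_\rho=(-P(\rho))^{-1/2}S_\rho$. A 2-form $\widetilde\omega$ is taming for $J_\rho$ if $\widetilde\omega(v,J_\rho v)>0$ for every non-zero $v\in V$. A 3-form $\varphi$ on a seven-dimensional vector space $W$ is definite if $\iota_w\varphi$ has rank six for each non-zero $w\in W$. A $\mathrm{G}_2$-structure on a seven-dimensional Lie algebra is a definite 3-form $\varphi$ on it; it is closed if $d\varphi=0$. Central extension: for a Lie algebra $(\mathfrak{h},[\cdot,\cdot]_{\mathfrak{h}})$ and a closed $\omega_0\in\Lambda^2\mathfrak{h}^*$, it is the vector space $\mathfrak{h}\oplus\mathbb{R}z$ with bracket $[z,\mathfrak{h}]=0$, $[x,y]=-\omega_0(x,y)z+[x,y]_{\mathfrak{h}}$ for $x,y\in\mathfrak{h}$ (so $\mathfrak{h}$ is a vector subspace, not necessarily a subalgebra). Forms on $\mathfrak{h}$ are extended to $\mathfrak{g}$ so that their contraction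 with $z$ vanishes. *)

theory Defs
  imports Complex_Main
begin

(* Vector spaces are linear subspaces V of an ambient type of class real_vector, with "dim" from
   the library; the seven-dimensional space is the whole type, so that its six-dimensional
   subspace can carry a bracket of its own. *)

definition lie_algebra_on :: "'a::real_vector set \<Rightarrow> ('a \<Rightarrow> 'a \<Rightarrow> 'a) \<Rightarrow> bool" where
  "lie_algebra_on V br \<longleftrightarrow>
     subspace V \<and>
     (\<forall>x\<in>V. \<forall>y\<in>V. br x y \<in> V) \<and>
     (\<forall>x\<in>V. \<forall>x'\<in>V. \<forall>y\<in>V. \<forall>c. br (c *\<^sub>R x + x') y = c *\<^sub>R br x y + br x' y) \<and>
     (\<forall>x\<in>V. \<forall>y\<in>V. \<forall>y'\<in>V. \<forall>c. br x (c *\<^sub>R y + y') = c *\<^sub>R br x y + br x y') \<and>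
     (\<forall>x\<in>V. br x x = 0) \<and>
     (\<forall>x\<in>V. \<forall>y\<in>V. \<forall>w\<in>V. br x (br y w) + br y (br w x) + br w (br x y) = 0)"

definition lie_center :: "'a::real_vector set \<Rightarrow> ('a \<Rightarrow> 'a \<Rightarrow> 'a) \<Rightarrow> 'a set" where
  "lie_center V br = {z \<in> V. \<forall>x\<in>V. br z x = 0}"


(* A k-form on V is a function on lists, of which only the values on k-tuples from V matter;
   accordingly equality of forms is agreement on those tuples (form_eq). *)

type_synonym 'a form = "'a list \<Rightarrow> real"

definition tuples :: "'a set \<Rightarrow> nat \<Rightarrow> 'a list set" where
  "tuples V k = {vs. length vs = k \<and> set vs \<subseteq> V}"

definition form_on :: "'a::real_vector set \<Rightarrow> nat \<Rightarrow> 'a form \<Rightarrow> bool" where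
  "form_on V k \<alpha> \<longleftrightarrow>
     (\<forall>us ws x y c. us @ x # ws \<in> tuples V k \<and> y \<in> V \<longrightarrow>
        \<alpha> (us @ (c *\<^sub>R x + y) # ws) = c * \<alpha> (us @ x # ws) + \<alpha> (us @ y # ws)) \<and>
     (\<forall>vs\<in>tuples V k. \<not> distinct vs \<longrightarrow> \<alpha> vs = 0)"

definition form_eq :: "'a set \<Rightarrow> nat \<Rightarrow> 'a form \<Rightarrow> 'a form \<Rightarrow> bool" where
  "form_eq V k \<alpha> \<beta> \<longleftrightarrow> (\<forall>vs\<in>tuples V k. \<alpha> vs = \<beta> vs)"

definition interior :: "'a \<Rightarrow> 'a form \<Rightarrow> 'a form" where
  "interior v \<alpha> = (\<lambda>vs. \<alpha> (v # vs))"

(* Shuffle formula for the wedge product of a p-form with a form of any degree: I is the set of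
   positions fed to the first factor, and the exponent counts the inversions of the corresponding
   shuffle. In particular (a wedge b)(x,y) = a(x) b(y) - a(y) b(x) for 1-forms. *)
definition wedge :: "nat \<Rightarrow> 'a form \<Rightarrow> 'a form \<Rightarrow> 'a form" where
  "wedge p \<alpha> \<beta> = (\<lambda>vs. \<Sum>I | I \<subseteq> {..<length vs} \<and> card I = p.
     (-1) ^ card {(i, j). i \<in> I \<and> j \<in> {..<length vs} - I \<and> j < i}
       * \<alpha> (nths vs I) * \<beta> (nths vs (- I)))"

(* Chevalley-Eilenberg differential:
   (d a)(x_0,...,x_k) = sum over i < j of (-1)^(i+j) a([x_i,x_j], the remaining x's in order);
   for 1-forms this is (d a)(x,y) = - a([x,y]). *)
definition ce_d :: "('a \<Rightarrow> 'a \<Rightarrow> 'a) \<Rightarrow> 'a form \<Rightarrow> 'a form" where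
  "ce_d br \<alpha> = (\<lambda>vs. \<Sum>(i, j) | i < j \<and> j < length vs.
     (-1) ^ (i + j) * \<alpha> (br (vs ! i) (vs ! j) # nths vs (- {i, j})))"

definition closed_form_on ::
    "'a::real_vector set \<Rightarrow> ('a \<Rightarrow> 'a \<Rightarrow> 'a) \<Rightarrow> nat \<Rightarrow> 'a form \<Rightarrow> bool" where
  "closed_form_on V br k \<alpha> \<longleftrightarrow> form_on V k \<alpha> \<and> form_eq V (Suc k) (ce_d br \<alpha>) (\<lambda>_. 0)"

definition nondegenerate_on :: "'a::real_vector set \<Rightarrow> 'a form \<Rightarrow> bool" where
  "nondegenerate_on V \<omega> \<longleftrightarrow> (\<forall>v\<in>V. v \<noteq> 0 \<longrightarrow> (\<exists>w\<in>V. \<omega> [v, w] \<noteq> 0))"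

definition symplectic_on :: "'a::real_vector set \<Rightarrow> ('a \<Rightarrow> 'a \<Rightarrow> 'a) \<Rightarrow> 'a form \<Rightarrow> bool" where
  "symplectic_on V br \<omega> \<longleftrightarrow> closed_form_on V br 2 \<omega> \<and> nondegenerate_on V \<omega>"

(* Rank of the map V -> V^* given by a 2-form, as the codimension of its kernel. *)
definition rank2 :: "'a::real_vector set \<Rightarrow> 'a form \<Rightarrow> nat" where
  "rank2 V \<beta> = dim V - dim {x \<in> V. \<forall>y\<in>V. \<beta> [x, y] = 0}"

definition definite6 :: "'a::real_vector set \<Rightarrow> 'a form \<Rightarrow> bool" where
  "definite6 V \<rho> \<longleftrightarrow> subspace V \<and> dim V = 6 \<and> form_on V 3 \<rho> \<and>
     (\<forall>v\<in>V. v \<noteq> 0 \<longrightarrow> rank2 V (interior v \<rho>) = 4)"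

definition definite7 :: "'a::real_vector set \<Rightarrow> 'a form \<Rightarrow> bool" where
  "definite7 V \<phi> \<longleftrightarrow> subspace V \<and> dim V = 7 \<and> form_on V 3 \<phi> \<and>
     (\<forall>w\<in>V. w \<noteq> 0 \<longrightarrow> rank2 V (interior w \<phi>) = 6)"

definition closed_G2_structure ::
    "'a::real_vector set \<Rightarrow> ('a \<Rightarrow> 'a \<Rightarrow> 'a) \<Rightarrow> 'a form \<Rightarrow> bool" where
  "closed_G2_structure V br \<phi> \<longleftrightarrow>
     lie_algebra_on V br \<and> definite7 V \<phi> \<and> closed_form_on V br 3 \<phi>"


(* An orientation of a six-dimensional V is represented by a non-zero 6-form; S_rho depends on
   the representative but J_rho only on its class up to positive scaling. *)
definition volume_form6 :: "'a::real_vector set \<Rightarrow> 'a form \<Rightarrow> bool" where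
  "volume_form6 V \<Omega> \<longleftrightarrow> form_on V 6 \<Omega> \<and> \<not> form_eq V 6 \<Omega> (\<lambda>_. 0)"

definition S_rho :: "'a::real_vector set \<Rightarrow> 'a form \<Rightarrow> 'a form \<Rightarrow> 'a \<Rightarrow> 'a" where
  "S_rho V \<Omega> \<rho> v = (THE w. w \<in> V \<and>
     (\<forall>\<eta>. form_on V 1 \<eta> \<longrightarrow>
        form_eq V 6 (wedge 5 (wedge 2 (interior v \<rho>) \<rho>) \<eta>) (\<lambda>vs. \<eta> [w] * \<Omega> vs)))"

definition P_rho :: "'a::real_vector set \<Rightarrow> 'a form \<Rightarrow> 'a form \<Rightarrow> real" where
  "P_rho V \<Omega> \<rho> = (THE p. \<forall>v\<in>V. S_rho V \<Omega> \<rho> (S_rho V \<Omega> \<rho> v) = p *\<^sub>R v)"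

definition J_rho :: "'a::real_vector set \<Rightarrow> 'a form \<Rightarrow> 'a form \<Rightarrow> 'a \<Rightarrow> 'a" where
  "J_rho V \<Omega> \<rho> v = ((- P_rho V \<Omega> \<rho>) powr (- 1 / 2)) *\<^sub>R S_rho V \<Omega> \<rho> v"

definition taming_on :: "'a::real_vector set \<Rightarrow> 'a form \<Rightarrow> ('a \<Rightarrow> 'a) \<Rightarrow> bool" where
  "taming_on V \<omega> J \<longleftrightarrow> (\<forall>v\<in>V. v \<noteq> 0 \<longrightarrow> \<omega> [v, J v] > 0)"


(* (UNIV, br) is the central extension of (H, brH) by the closed 2-form w0 on H, with the
   underlying direct sum decomposition UNIV = H + R z. *)
definition central_extension ::
    "('a::real_vector \<Rightarrow> 'a \<Rightarrow> 'a) \<Rightarrow> 'a set \<Rightarrow> ('a \<Rightarrow> 'a \<Rightarrow> 'a) \<Rightarrow> 'a form \<Rightarrow> 'a \<Rightarrow> bool" where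
  "central_extension br H brH \<omega>0 z \<longleftrightarrow>
     lie_algebra_on UNIV br \<and> lie_algebra_on H brH \<and> closed_form_on H brH 2 \<omega>0 \<and>
     z \<notin> H \<and> span (insert z H) = UNIV \<and>
     (\<forall>x\<in>H. br z x = 0) \<and>
     (\<forall>x\<in>H. \<forall>y\<in>H. br x y = - \<omega>0 [x, y] *\<^sub>R z + brH x y)"

(* Extension of a form from H to H + R z by zero contraction with z. When theta vanishes on H
   and theta(z) = 1, the map x |-> x - theta(x) z is the projection onto H along z. *)
definition extend_form :: "'a form \<Rightarrow> 'a::real_vector \<Rightarrow> 'a form \<Rightarrow> 'a form" where
  "extend_form \<theta> z \<alpha> = (\<lambda>vs. \<alpha> (map (\<lambda>x. x - \<theta> [x] *\<^sub>R z) vs))"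

end

theory Submission
  imports Defs
begin

text \<open>Take \<open>H = ker \<theta>\<close> with the bracket of the quotient by \<open>z\<close>, \<open>\<omega>\<^sub>0 = -\<theta>([\<cdot>,\<cdot>])\<close>, \<open>\<omega> = \<iota>\<^sub>z\<phi>\<close> and
  \<open>\<rho> = \<phi>\<close> restricted to \<open>H\<close>. The differential identities are the components of \<open>d\<phi> = 0\<close> with and
  without \<open>z\<close>. For \<open>v \<in> H\<close> nonzero the form \<open>\<iota>\<^sub>v\<phi>\<close> has kernel spanned by \<open>v\<close>, so \<open>\<theta> = \<iota>\<^sub>u\<iota>\<^sub>v\<phi>\<close> for
  some \<open>u\<close>, and \<open>v, u\<close> span the kernel of \<open>\<iota>\<^sub>v\<rho>\<close>; hence \<open>\<rho>\<close> is definite.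

  For a definite \<open>\<rho>\<close> let \<open>S\<close> be \<open>S\<^sub>\<rho>\<close>; evaluation in a basis starting with the kernel \<open>v, u\<close> of \<open>\<iota>\<^sub>v\<rho>\<close> shows that \<open>S v\<close>
  and \<open>v\<close> span this kernel. As \<open>\<iota>\<^sub>v\<iota>\<^bsub>S v\<^esub>\<rho> = 0\<close> while \<open>\<iota>\<^sub>v\<phi>\<close> has kernel spanned by \<open>v\<close> only,
  \<open>\<omega>(v, S v) = \<phi>(v, S v, z)\<close> is nonzero. A quadratic form without nontrivial zeros is definite, so
  \<open>\<omega>\<close> tames \<open>J\<close> for one of the two orientations.\<close>

section \<open>Wedge products and alternating forms\<close>

lemma wedge_0: "wedge 0 \<alpha> \<beta> vs = \<alpha> [] * \<beta> vs"
proof -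
  have "{I. I \<subseteq> {..<length vs} \<and> card I = 0} = {{}}"
    by (auto dest: finite_subset simp: card_eq_0_iff)
  then show ?thesis
    unfolding wedge_def by (simp only:) (simp add: nths_all)
qed

lemma wedge_Suc_Nil: "wedge (Suc p) \<alpha> \<beta> [] = 0"
  by (simp add: wedge_def)

text \<open>The shuffles are split by which factor receives position 0. In the first factor it
  causes no inversion; in the second it is inverted with each of the \<open>Suc p\<close> positions
  of the first factor, whence the sign. This recursion makes wedge products computable on concrete
  lists.\<close>

lemma wedge_Suc_Cons:
  "wedge (Suc p) \<alpha> \<beta> (x # xs) =
     wedge p (interior x \<alpha>) \<beta> xs + (-1) ^ Suc p * wedge (Suc p) \<alpha> (interior x \<beta>) xs"
proof -
  let ?n = "length xs"
  define inv where "inv = (\<lambda>n I. {(i::nat, j). i \<in> I \<and> j \<in> {..<n} - I \<and> j < i})"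
  have inv_eq: "{(i, j). i \<in> I \<and> j \<in> {..<n} - I \<and> j < i} = inv n I" for n I
    by (simp add: inv_def)
  define T where "T = (\<lambda>I. (-1::real) ^ card (inv (Suc ?n) I)
       * \<alpha> (nths (x # xs) I) * \<beta> (nths (x # xs) (- I)))"
  define A where "A = {J. J \<subseteq> {..<?n} \<and> card J = p}"
  define B where "B = {J. J \<subseteq> {..<?n} \<and> card J = Suc p}"
  have split: "{I. I \<subseteq> {..<Suc ?n} \<and> card I = Suc p} =
      (\<lambda>J. insert 0 (Suc ` J)) ` A \<union> (\<lambda>J. Suc ` J) ` B" (is "?L = ?R")
  proof
    show "?L \<subseteq> ?R"
    proof
      fix I assume "I \<in> ?L"
      then have I: "I \<subseteq> {..<Suc ?n}" "card I = Suc p" by auto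
      define J where "J = {j. Suc j \<in> I}"
      have fI: "finite I" using I(1) finite_subset by blast
      have J: "J \<subseteq> {..<?n}" using I by (auto simp: J_def)
      have fJ: "finite J" using J finite_subset by blast
      show "I \<in> ?R"
      proof (cases "0 \<in> I")
        case True
        have eq: "I = insert 0 (Suc ` J)"
          using True by (auto simp: J_def image_iff) (metis not0_implies_Suc)
        have "card I = Suc (card J)" unfolding eq using fJ by (simp add: card_image)
        then show ?thesis using I J eq by (auto simp: A_def)
      next
        case False
        have eq: "I = Suc ` J"
          using False by (auto simp: J_def image_iff) (metis not0_implies_Suc)
        have "card I = card J" unfolding eq by (simp add: card_image)
        then show ?thesis using I J eq by (auto simp: B_def)
      qed
    qed
    show "?R \<subseteq> ?L"
      by (auto simp: A_def B_def card_image card_insert_if finite_subset[OF _ finite_lessThan])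
  qed
  have fin: "finite A" "finite B" by (simp_all add: A_def B_def)
  have inj1: "inj_on (\<lambda>J. insert 0 (Suc ` J)) A"
    by (rule inj_onI, auto simp: insert_eq_iff image_iff inj_image_eq_iff)
  have inj2: "inj_on (\<lambda>J. Suc ` J) B"
    by (rule inj_onI) (simp add: inj_image_eq_iff)
  have T1: "T (insert 0 (Suc ` J)) = (-1) ^ card (inv ?n J)
       * interior x \<alpha> (nths xs J) * \<beta> (nths xs (- J))" for J
  proof -
    have "inv (Suc ?n) (insert 0 (Suc ` J)) = map_prod Suc Suc ` inv ?n J"
      by (auto simp: inv_def image_iff less_Suc_eq_0_disj lessThan_Suc_eq_insert_0)
    moreover have "inj_on (map_prod Suc Suc) (inv ?n J)" by (auto simp: inj_on_def)
    ultimately have "card (inv (Suc ?n) (insert 0 (Suc ` J))) = card (inv ?n J)"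
      by (simp add: card_image)
    moreover have "{j. Suc j \<in> insert 0 (Suc ` J)} = J" "{j. Suc j \<in> - insert 0 (Suc ` J)} = - J"
      by auto
    ultimately show ?thesis by (simp add: T_def nths_Cons interior_def)
  qed
  have T2: "T (Suc ` J) = (-1) ^ Suc p * ((-1) ^ card (inv ?n J)
       * \<alpha> (nths xs J) * interior x \<beta> (nths xs (- J)))" if "J \<in> B" for J
  proof -
    have J: "J \<subseteq> {..<?n}" "card J = Suc p" using that by (auto simp: B_def)
    then have fJ: "finite J" by (meson finite_lessThan finite_subset)
    have "finite (inv ?n J)"
      by (rule finite_subset[of _ "J \<times> {..<?n}"]) (auto simp: inv_def fJ)
    \<comment> \<open>The second set holds the new inversions: one pair with 0 for every element of
      \<open>J\<close>, so \<open>Suc p\<close> in all.\<close>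
    moreover have "inv (Suc ?n) (Suc ` J) = map_prod Suc Suc ` inv ?n J \<union> (\<lambda>j. (Suc j, 0)) ` J"
      by (auto simp: inv_def image_iff less_Suc_eq_0_disj lessThan_Suc_eq_insert_0)
    moreover have "inj_on (map_prod Suc Suc) (inv ?n J)" "inj_on (\<lambda>j. (Suc j, 0::nat)) J"
      by (auto simp: inj_on_def)
    moreover have "map_prod Suc Suc ` inv ?n J \<inter> (\<lambda>j. (Suc j, 0)) ` J = {}" by auto
    ultimately have "card (inv (Suc ?n) (Suc ` J)) = card (inv ?n J) + Suc p"
      using fJ J by (simp add: card_image card_Un_disjoint)
    moreover have "{j. Suc j \<in> Suc ` J} = J" "{j. Suc j \<in> - (Suc ` J)} = - J" "0 \<notin> Suc ` J"
      by auto
    ultimately show ?thesis by (simp add: T_def nths_Cons interior_def power_add)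
  qed
  have "wedge (Suc p) \<alpha> \<beta> (x # xs) = (\<Sum>I\<in>(\<lambda>J. insert 0 (Suc ` J)) ` A \<union> (\<lambda>J. Suc ` J) ` B. T I)"
    unfolding split[symmetric] by (simp add: wedge_def T_def inv_def)
  also have "\<dots> = (\<Sum>I\<in>(\<lambda>J. insert 0 (Suc ` J)) ` A. T I) + (\<Sum>I\<in>(\<lambda>J. Suc ` J) ` B. T I)"
    using fin by (intro sum.union_disjoint) auto
  also have "(\<Sum>I\<in>(\<lambda>J. insert 0 (Suc ` J)) ` A. T I) = wedge p (interior x \<alpha>) \<beta> xs"
    unfolding wedge_def A_def[symmetric] inv_eq
    by (simp only: sum.reindex[OF inj1] o_def T1)
  also have "(\<Sum>I\<in>(\<lambda>J. Suc ` J) ` B. T I) = (-1) ^ Suc p * wedge (Suc p) \<alpha> (interior x \<beta>) xs"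
    unfolding wedge_def B_def[symmetric] inv_eq sum_distrib_left
    by (simp add: sum.reindex[OF inj2] T2)
  finally show ?thesis .
qed

lemmas wedge_simps = wedge_0 wedge_Suc_Nil wedge_Suc_Cons

lemma wedge_2_3: "wedge 2 \<alpha> \<beta> [x, y, w] =
    \<alpha> [x, y] * \<beta> [w] - \<alpha> [x, w] * \<beta> [y] + \<alpha> [y, w] * \<beta> [x]"
  by (simp add: numeral_eq_Suc wedge_simps interior_def)

lemma wedge_2_4: "wedge 2 \<alpha> \<beta> [x, y, w, t] =
    \<alpha> [x, y] * \<beta> [w, t] - \<alpha> [x, w] * \<beta> [y, t] + \<alpha> [x, t] * \<beta> [y, w]
    + \<alpha> [y, w] * \<beta> [x, t] - \<alpha> [y, t] * \<beta> [x, w] + \<alpha> [w, t] * \<beta> [x, y]"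
  by (simp add: numeral_eq_Suc wedge_simps interior_def)

lemma wedge_2_5: "wedge 2 \<alpha> \<beta> [a, b, c, d, e] =
    \<alpha> [a, b] * \<beta> [c, d, e] - \<alpha> [a, c] * \<beta> [b, d, e] + \<alpha> [a, d] * \<beta> [b, c, e]
    - \<alpha> [a, e] * \<beta> [b, c, d] + \<alpha> [b, c] * \<beta> [a, d, e] - \<alpha> [b, d] * \<beta> [a, c, e]
    + \<alpha> [b, e] * \<beta> [a, c, d] + \<alpha> [c, d] * \<beta> [a, b, e] - \<alpha> [c, e] * \<beta> [a, b, d]
    + \<alpha> [d, e] * \<beta> [a, b, c]"
  by (simp add: numeral_eq_Suc wedge_simps interior_def)

lemma wedge_5_6: "wedge 5 \<alpha> \<beta> [a, b, c, d, e, f] =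
    \<alpha> [a, b, c, d, e] * \<beta> [f] - \<alpha> [a, b, c, d, f] * \<beta> [e] + \<alpha> [a, b, c, e, f] * \<beta> [d]
    - \<alpha> [a, b, d, e, f] * \<beta> [c] + \<alpha> [a, c, d, e, f] * \<beta> [b] - \<alpha> [b, c, d, e, f] * \<beta> [a]"
  by (simp add: numeral_eq_Suc wedge_simps interior_def)

lemma ce_d_3: "ce_d br \<alpha> [x, y, w] =
    - \<alpha> [br x y, w] + \<alpha> [br x w, y] - \<alpha> [br y w, x]"
proof -
  have "{(i, j). i < j \<and> j < length [x, y, w]} = {(0, 1), (0, 2), (1, 2)}"
    by (auto simp: numeral_eq_Suc less_Suc_eq)
  then show ?thesis
    unfolding ce_d_def by (simp only:) (simp add: nths_Cons numeral_eq_Suc)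
qed

lemma ce_d_4: "ce_d br \<alpha> [x, y, w, t] =
    - \<alpha> [br x y, w, t] + \<alpha> [br x w, y, t] - \<alpha> [br x t, y, w]
    - \<alpha> [br y w, x, t] + \<alpha> [br y t, x, w] - \<alpha> [br w t, x, y]"
proof -
  have "{(i, j). i < j \<and> j < length [x, y, w, t]} =
      {(0, 1), (0, 2), (0, 3), (1, 2), (1, 3), (2, 3)}"
    by (auto simp: numeral_eq_Suc less_Suc_eq)
  then show ?thesis
    unfolding ce_d_def by (simp only:) (simp add: nths_Cons numeral_eq_Suc)
qed

section \<open>Alternating forms: swaps, permutations and values on a basis\<close>

lemma tuples_append [simp]:
  "us @ ws \<in> tuples V k \<longleftrightarrow> length us + length ws = k \<and> set us \<subseteq> V \<and> set ws \<subseteq> V"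
  by (auto simp: tuples_def)

lemma tuples_Cons [simp]:
  "x # vs \<in> tuples V k \<longleftrightarrow> k = Suc (length vs) \<and> x \<in> V \<and> set vs \<subseteq> V"
  by (auto simp: tuples_def)

lemma form_on_linear:
  assumes "form_on V k \<alpha>" "us @ x # ws \<in> tuples V k" "y \<in> V"
  shows "\<alpha> (us @ (c *\<^sub>R x + y) # ws) = c * \<alpha> (us @ x # ws) + \<alpha> (us @ y # ws)"
  using assms unfolding form_on_def by blast

lemma form_on_not_distinct:
  "form_on V k \<alpha> \<Longrightarrow> vs \<in> tuples V k \<Longrightarrow> \<not> distinct vs \<Longrightarrow> \<alpha> vs = 0"
  unfolding form_on_def by blast

lemma tuples_mono: "vs \<in> tuples U k \<Longrightarrow> U \<subseteq> V \<Longrightarrow> vs \<in> tuples V k"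
  by (auto simp: tuples_def)

lemma form_on_subset: "form_on V k \<alpha> \<Longrightarrow> U \<subseteq> V \<Longrightarrow> form_on U k \<alpha>"
  unfolding form_on_def by (meson subsetD tuples_mono)

lemma form_on_interior:
  assumes "form_on V (Suc k) \<alpha>" "x \<in> V"
  shows "form_on V k (interior x \<alpha>)"
  unfolding form_on_def interior_def
proof safe
  fix us ws v y and c :: real
  assume *: "us @ v # ws \<in> tuples V k" "y \<in> V"
  then have "(x # us) @ v # ws \<in> tuples V (Suc k)" using assms(2) by auto
  from form_on_linear[OF assms(1) this *(2), of c]
  show "\<alpha> (x # us @ (c *\<^sub>R v + y) # ws) = c * \<alpha> (x # us @ v # ws) + \<alpha> (x # us @ y # ws)"
    by simp
next
  fix vs assume "vs \<in> tuples V k" "\<not> distinct vs"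
  then show "\<alpha> (x # vs) = 0"
    using form_on_not_distinct[OF assms(1), of "x # vs"] assms(2) by (auto simp: tuples_def)
qed

text \<open>Polarization: expand the value with \<open>x + y\<close> in both adjacent slots. Only
  vanishing on adjacent repetitions is assumed, so that the lemma is available before a function is
  known to be a form.\<close>

lemma adjacent_swap:
  assumes "subspace V"
    and lin: "\<And>us x ws y c. us @ x # ws \<in> tuples V k \<Longrightarrow> y \<in> V \<Longrightarrow>
      \<alpha> (us @ (c *\<^sub>R x + y) # ws) = c * \<alpha> (us @ x # ws) + \<alpha> (us @ y # ws)"
    and adj: "\<And>us x ws. us @ x # x # ws \<in> tuples V k \<Longrightarrow> \<alpha> (us @ x # x # ws) = 0"
    and t: "us @ x # y # ws \<in> tuples V k"
  shows "\<alpha> (us @ x # y # ws) = - \<alpha> (us @ y # x # ws)"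
proof -
  have V: "x \<in> V" "y \<in> V" "x + y \<in> V" using t assms(1) by (auto simp: subspace_add)
  have "0 = \<alpha> (us @ (x + y) # (x + y) # ws)" using t V by (subst adj) auto
  also have "\<dots> = \<alpha> (us @ x # (x + y) # ws) + \<alpha> (us @ y # (x + y) # ws)"
    using lin[of us x "(x + y) # ws" y 1] t V by auto
  also have "\<alpha> (us @ x # (x + y) # ws) = \<alpha> (us @ x # y # ws)"
    using lin[of "us @ [x]" x ws y 1] adj[of us x ws] t V by auto
  also have "\<alpha> (us @ y # (x + y) # ws) = \<alpha> (us @ y # x # ws)"
    using lin[of "us @ [y]" x ws y 1] adj[of us y ws] t V by auto
  finally show ?thesis by simp
qed

text \<open>Adjacent swaps bring two equal entries next to each other, so adjacent repetitions are
  the only ones to check. Wedge products are shown to be alternating in this way.\<close>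

lemma form_onI_adjacent:
  assumes "subspace V"
    and lin: "\<And>us x ws y c. us @ x # ws \<in> tuples V k \<Longrightarrow> y \<in> V \<Longrightarrow>
      \<alpha> (us @ (c *\<^sub>R x + y) # ws) = c * \<alpha> (us @ x # ws) + \<alpha> (us @ y # ws)"
    and adj: "\<And>us x ws. us @ x # x # ws \<in> tuples V k \<Longrightarrow> \<alpha> (us @ x # x # ws) = 0"
  shows "form_on V k \<alpha>"
proof -
  have zero: "as @ x # bs @ x # cs \<in> tuples V k \<Longrightarrow> \<alpha> (as @ x # bs @ x # cs) = 0" for as x bs cs
  proof (induction bs arbitrary: as)
    case Nil
    then show ?case using adj by simp
  next
    case (Cons b bs)
    then show ?case
      using adjacent_swap[where us = as and x = x and y = b and ws = "bs @ x # cs", OF assms] Cons.IH[of "as @ [b]"] by auto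
  qed
  show ?thesis
    unfolding form_on_def
  proof safe
    fix vs assume vs: "vs \<in> tuples V k" "\<not> distinct vs"
    then obtain as bs cs x where "vs = as @ [x] @ bs @ [x] @ cs"
      using not_distinct_decomp by blast
    then show "\<alpha> vs = 0" using zero vs by simp
  qed (use lin in blast)
qed

lemma form_on_swap:
  assumes "subspace V" "form_on V k \<alpha>" "us @ x # y # ws \<in> tuples V k"
  shows "\<alpha> (us @ x # y # ws) = - \<alpha> (us @ y # x # ws)"
proof (rule adjacent_swap[OF assms(1) _ _ assms(3)])
  show "\<alpha> (us @ x # x # ws) = 0" if "us @ x # x # ws \<in> tuples V k" for us x ws
    using form_on_not_distinct[OF assms(2) that] by simp
qed (use form_on_linear[OF assms(2)] in blast)

text \<open>Absolute values spare the sign of the permutation; the application only asks whether a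
  value is zero. The fixed prefix \<open>us\<close> carries the induction.\<close>

lemma form_on_abs_permute:
  assumes "subspace V" "form_on V k \<alpha>" "us @ xs \<in> tuples V k"
    and "distinct xs" "distinct ys" "set xs = set ys"
  shows "\<bar>\<alpha> (us @ xs)\<bar> = \<bar>\<alpha> (us @ ys)\<bar>"
  using assms(3-)
proof (induction xs arbitrary: us ys)
  case (Cons x xs)
  obtain as bs where ys: "ys = as @ x # bs"
    using Cons.prems(4) by (metis list.set_intros(1) split_list)
  have move: "us @ as @ x # bs \<in> tuples V k \<Longrightarrow>
      \<bar>\<alpha> (us @ as @ x # bs)\<bar> = \<bar>\<alpha> (us @ x # as @ bs)\<bar>" for us as
  proof (induction as arbitrary: us)
    case (Cons a as)
    have "\<bar>\<alpha> (us @ (a # as) @ x # bs)\<bar> = \<bar>\<alpha> (us @ a # x # as @ bs)\<bar>"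
      using Cons.IH[of "us @ [a]"] Cons.prems by simp
    also have "\<dots> = \<bar>\<alpha> (us @ x # a # as @ bs)\<bar>"
      using form_on_swap[OF assms(1,2), of us a x "as @ bs"] Cons.prems by simp
    finally show ?case by simp
  qed simp
  have s: "set xs = set (as @ bs)" "distinct (as @ bs)"
    using Cons.prems unfolding ys by auto
  have "length xs = length (as @ bs)"
    using s Cons.prems(2) by (metis distinct.simps(2) distinct_card)
  then have "us @ as @ x # bs \<in> tuples V k"
    using Cons.prems(1) s by auto
  from move[OF this] show ?case
    using Cons.IH[of "us @ [x]" "as @ bs"] Cons.prems s by (simp add: ys)
qed simp

lemma form_on_eq_0_span:
  assumes "form_on (span B) k \<alpha>"
    and B: "\<And>vs. vs \<in> tuples B k \<Longrightarrow> \<alpha> vs = 0"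
    and "vs \<in> tuples (span B) k"
  shows "\<alpha> vs = 0"
proof -
  \<comment> \<open>Slots are reduced one at a time from the right: \<open>us\<close> still holds
    arbitrary vectors of the span, \<open>ws\<close> already consists of generators.\<close>
  have "us @ ws \<in> tuples (span B) k \<Longrightarrow> set ws \<subseteq> B \<Longrightarrow> \<alpha> (us @ ws) = 0" for us ws
  proof (induction us arbitrary: ws rule: rev_induct)
    case Nil
    then show ?case by (auto intro: B simp: tuples_def)
  next
    case (snoc x us)
    have t: "us @ y # ws \<in> tuples (span B) k" if "y \<in> span B" for y
      using snoc.prems that by auto
    have "x \<in> span B" using snoc.prems by simp
    then have "x \<in> span B \<and> \<alpha> (us @ x # ws) = 0"
    proof (induction rule: span_induct_alt)
      case base
      show ?case
        using form_on_linear[OF assms(1) t[of 0], of 0 1] by (simp add: span_zero)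
    next
      case (step c b y)
      have b: "b \<in> span B" using step by (simp add: span_base)
      have "\<alpha> (us @ b # ws) = 0"
        using snoc.IH[of "b # ws"] t[OF b] step(1) snoc.prems by simp
      then show ?case
        using form_on_linear[OF assms(1) t[OF b], of y c] step b
        by (simp add: span_add span_scale)
    qed
    then show ?case by simp
  qed
  from this[of vs "[]"] show ?thesis using assms(3) by (simp add: tuples_def)
qed

text \<open>A \<open>k\<close>-tuple drawn from \<open>k\<close> vectors either repeats an entry or
  permutes them, so one value settles a form of top degree. Identities of 6-forms are later checked
  on a single basis for this reason.\<close>

lemma form_on_eq_0_basis:
  assumes "form_on V k \<alpha>" "distinct bs" "length bs = k" "span (set bs) = V" "\<alpha> bs = 0"
    and "vs \<in> tuples V k"
  shows "\<alpha> vs = 0"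
proof (rule form_on_eq_0_span[of "set bs" k])
  fix ws assume ws: "ws \<in> tuples (set bs) k"
  have V: "subspace V" "set bs \<subseteq> V" using assms(4) span_superset by auto
  show "\<alpha> ws = 0"
  proof (cases "distinct ws")
    case True
    have "set ws = set bs"
      using ws True assms(2,3) by (intro card_subset_eq) (auto simp: tuples_def distinct_card)
    then have "\<bar>\<alpha> ([] @ bs)\<bar> = \<bar>\<alpha> ([] @ ws)\<bar>"
      using assms V True by (intro form_on_abs_permute[of V k]) (auto simp: tuples_def)
    then show ?thesis using assms(5) by simp
  next
    case False
    then show ?thesis
      using form_on_not_distinct[OF assms(1), of ws] ws V by (auto simp: tuples_def)
  qed
qed (use assms in auto)

lemma form_on_diff_scaled:
  assumes "form_on V k \<alpha>" "form_on V k \<beta>"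
  shows "form_on V k (\<lambda>vs. \<alpha> vs - c * \<beta> vs)"
  using assms unfolding form_on_def by (simp add: algebra_simps)

section \<open>The wedge product of two forms is a form\<close>

lemma length_nths_card:
  assumes "I \<subseteq> {..<length vs}" shows "length (nths vs I) = card I"
    and "length (nths vs (- I)) = length vs - card I"
proof -
  have "{i. i < length vs \<and> i \<in> I} = I" "{i. i < length vs \<and> i \<in> - I} = {..<length vs} - I"
    using assms by auto
  then show "length (nths vs I) = card I" "length (nths vs (- I)) = length vs - card I"
    using assms by (simp_all only: length_nths) (simp add: card_Diff_subset finite_subset)
qed

lemma wedge_eq_0:
  assumes "\<And>us ws. length us = p \<Longrightarrow> length us + length ws = length vs \<Longrightarrow>
      set us \<subseteq> set vs \<Longrightarrow> set ws \<subseteq> set vs \<Longrightarrow> \<alpha> us = 0 \<or> \<beta> ws = 0"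
  shows "wedge p \<alpha> \<beta> vs = 0"
  unfolding wedge_def
proof (intro sum.neutral ballI)
  fix I assume "I \<in> {I. I \<subseteq> {..<length vs} \<and> card I = p}"
  then have I: "I \<subseteq> {..<length vs}" "card I = p" by auto
  moreover have "card I \<le> length vs"
    using card_mono[OF _ I(1)] by simp
  ultimately have "\<alpha> (nths vs I) = 0 \<or> \<beta> (nths vs (- I)) = 0"
    by (intro assms) (auto simp: length_nths_card dest: in_set_nthsD)
  then show "(-1) ^ card {(i, j). i \<in> I \<and> j \<in> {..<length vs} - I \<and> j < i}
       * \<alpha> (nths vs I) * \<beta> (nths vs (- I)) = 0" by auto
qed

text \<open>Each shuffle sends the slot \<open>length us\<close> to exactly one of the two factors,
  so the claim holds term by term.\<close>

lemma wedge_linear: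
  assumes "form_on V p \<alpha>" "form_on V q \<beta>" "us @ x # ws \<in> tuples V (p + q)" "y \<in> V"
  shows "wedge p \<alpha> \<beta> (us @ (c *\<^sub>R x + y) # ws) =
    c * wedge p \<alpha> \<beta> (us @ x # ws) + wedge p \<alpha> \<beta> (us @ y # ws)"
proof -
  have main: "\<alpha> (nths (us @ (c *\<^sub>R x + y) # ws) I) * \<beta> (nths (us @ (c *\<^sub>R x + y) # ws) (- I)) =
      c * (\<alpha> (nths (us @ x # ws) I) * \<beta> (nths (us @ x # ws) (- I)))
      + \<alpha> (nths (us @ y # ws) I) * \<beta> (nths (us @ y # ws) (- I))"
    if I: "I \<subseteq> {..<length (us @ x # ws)}" "card I = p" for I
  proof -
    have len: "length us + length (x # ws) = p + q" using assms(3) by simp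
    have t: "nths (us @ x # ws) I \<in> tuples V p" "nths (us @ x # ws) (- I) \<in> tuples V q"
      using length_nths_card[OF I(1)] I(2) len assms(3)
        subset_trans[OF set_nths_subset, of "us @ x # ws" V]
      by (auto simp: tuples_def simp del: set_append)
    show ?thesis
    proof (cases "length us \<in> I")
      case True
      show ?thesis
        using form_on_linear[OF assms(1) _ assms(4), of "nths us I" x "nths ws {j. Suc (j + length us) \<in> I}" c]
          t True by (simp add: nths_append nths_Cons algebra_simps)
    next
      case False
      show ?thesis
        using form_on_linear[OF assms(2) _ assms(4), of "nths us (- I)" x "nths ws {j. Suc (j + length us) \<notin> I}" c]
          t False by (simp add: nths_append nths_Cons algebra_simps)
    qed
  qed
  define N where "N = Suc (length us + length ws)"
  define T where "T = (\<lambda>v I. \<alpha> (nths (us @ v # ws) I) * \<beta> (nths (us @ v # ws) (- I)))"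
  define s where "s = (\<lambda>I. (-1::real) ^ card {(i, j). i \<in> I \<and> j \<in> {..<N} - I \<and> j < i})"
  have w: "wedge p \<alpha> \<beta> (us @ v # ws) = (\<Sum>I | I \<subseteq> {..<N} \<and> card I = p. s I * T v I)" for v
    by (simp add: wedge_def N_def s_def T_def mult.assoc)
  have T: "T (c *\<^sub>R x + y) I = c * T x I + T y I" if "I \<subseteq> {..<N}" "card I = p" for I
    using main[of I] that by (simp add: N_def T_def)
  have "(\<Sum>I | I \<subseteq> {..<N} \<and> card I = p. s I * T (c *\<^sub>R x + y) I) =
      (\<Sum>I | I \<subseteq> {..<N} \<and> card I = p. c * (s I * T x I) + s I * T y I)"
    by (intro sum.cong) (simp_all add: T distrib_left mult.left_commute)
  then show ?thesis unfolding w by (simp add: sum.distrib sum_distrib_left)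
qed

text \<open>The entries before the repeated pair are peeled off by \<open>wedge_Suc_Cons\<close>.
  For a pair at the front the recursion is applied twice: terms with both copies in one factor
  vanish, and the two mixed terms cancel by their signs.\<close>

lemma wedge_adjacent:
  assumes "form_on V p \<alpha>" "form_on V q \<beta>" "us @ x # x # ws \<in> tuples V (p + q)"
  shows "wedge p \<alpha> \<beta> (us @ x # x # ws) = 0"
  using assms
proof (induction us arbitrary: p q \<alpha> \<beta>)
  case Nil
  have xV: "x \<in> V" "set ws \<subseteq> V" using Nil by auto
  have zero: "wedge r \<gamma> (interior x (interior x \<beta>)) ws = 0" if "p = r" for r \<gamma>
  proof (rule wedge_eq_0)
    fix us vs :: "'a list"
    assume "length us = r" "length us + length vs = length ws" "set vs \<subseteq> set ws"
    then have "x # x # vs \<in> tuples V q" using Nil.prems(3) xV that by (auto simp: tuples_def)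
    from form_on_not_distinct[OF Nil.prems(2) this]
    show "\<gamma> us = 0 \<or> interior x (interior x \<beta>) vs = 0" by (simp add: interior_def)
  qed
  have zero': "wedge r (interior x (interior x \<alpha>)) \<gamma> ws = 0" if "p = Suc (Suc r)" for r \<gamma>
  proof (rule wedge_eq_0)
    fix us vs :: "'a list"
    assume "length us = r" "set us \<subseteq> set ws"
    then have "x # x # us \<in> tuples V p" using xV that by (auto simp: tuples_def)
    from form_on_not_distinct[OF Nil.prems(1) this]
    show "interior x (interior x \<alpha>) us = 0 \<or> \<gamma> vs = 0" by (simp add: interior_def)
  qed
  consider "p = 0" | "p = 1" | r where "p = Suc (Suc r)"
    by (metis One_nat_def not0_implies_Suc)
  then show ?case
  proof cases
    case 1
    then show ?thesis
      using form_on_not_distinct[OF Nil.prems(2), of "x # x # ws"] Nil.prems(3)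
      by (simp add: wedge_simps)
  next
    case 2
    then show ?thesis using zero[of 1 \<alpha>] by (simp add: wedge_simps) (simp add: interior_def)
  next
    case 3
    then show ?thesis using zero[OF 3, of \<alpha>] zero'[OF 3] by (simp add: wedge_simps)
  qed
next
  case (Cons u us)
  have uV: "u \<in> V" using Cons.prems by simp
  show ?case
  proof (cases p)
    case 0
    then show ?thesis
      using form_on_not_distinct[OF Cons.prems(2), of "(u # us) @ x # x # ws"] Cons.prems(3)
      by (simp add: wedge_simps)
  next
    case (Suc p')
    have "wedge p' (interior u \<alpha>) \<beta> (us @ x # x # ws) = 0"
      using Cons.prems Suc uV by (intro Cons.IH[of p' _ q]) (auto intro: form_on_interior)
    moreover have "wedge p \<alpha> (interior u \<beta>) (us @ x # x # ws) = 0"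
    proof (cases q)
      case 0
      \<comment> \<open>With \<open>q = 0\<close> only \<open>p - 1\<close> entries remain, too few
        for the first factor, so the product vanishes.\<close>
      then show ?thesis using Cons.prems(3) by (intro wedge_eq_0) auto
    next
      case (Suc q')
      then show ?thesis
        using Cons.prems uV by (intro Cons.IH[of p _ q']) (auto intro: form_on_interior)
    qed
    ultimately show ?thesis using Suc by (simp add: wedge_simps)
  qed
qed

lemma form_on_wedge:
  assumes "subspace V" "form_on V p \<alpha>" "form_on V q \<beta>"
  shows "form_on V (p + q) (wedge p \<alpha> \<beta>)"
  using assms by (intro form_onI_adjacent) (auto intro!: wedge_linear wedge_adjacent)

section \<open>Definite 3-forms in dimension six\<close>

lemma form_on_1_linear:
  assumes "form_on V 1 \<eta>" "subspace V" "x \<in> V" "y \<in> V"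
  shows "\<eta> [x + y] = \<eta> [x] + \<eta> [y]" "\<eta> [c *\<^sub>R x] = c * \<eta> [x]" "\<eta> [x - y] = \<eta> [x] - \<eta> [y]"
proof -
  have *: "\<eta> [c *\<^sub>R x + y] = c * \<eta> [x] + \<eta> [y]" if "x \<in> V" "y \<in> V" for c x y
    using form_on_linear[OF assms(1), of "[]" x "[]" y c] that by simp
  have 0: "0 \<in> V" "\<eta> [0] = 0" using *[of 0 0 1] assms(2) by (auto simp: subspace_0)
  show "\<eta> [x + y] = \<eta> [x] + \<eta> [y]" "\<eta> [c *\<^sub>R x] = c * \<eta> [x]" "\<eta> [x - y] = \<eta> [x] - \<eta> [y]"
    using *[of x y 1] *[of x 0 c] *[of y x "-1"] assms 0 by auto
qed

lemma form_on_1I: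
  assumes "linear g" shows "form_on V 1 (\<lambda>vs. g (hd vs))"
  using assms unfolding form_on_def
  by (auto simp: tuples_def append_eq_Cons_conv length_Suc_conv linear_add linear_scale)

text \<open>If \<open>w - w'\<close> were nonzero, some functional would take the value 1 on it.
  This yields the uniqueness of the vector that defines \<open>S_rho\<close>.\<close>

lemma form_on_1_separates:
  assumes "subspace V" "w \<in> V" "w' \<in> V" "\<And>\<eta>. form_on V 1 \<eta> \<Longrightarrow> \<eta> [w] = \<eta> [w']"
  shows "w = w'"
proof (rule ccontr)
  assume "w \<noteq> w'"
  then have "independent {w - w'}" by simp
  then obtain g where g: "linear g" "g (w - w') = (1::real)"
    using linear_independent_extend[of "{w - w'}" "\<lambda>_. 1::real"] by auto
  then show False using assms(4)[OF form_on_1I[OF g(1)]] by (simp add: linear_diff)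
qed

lemma form_on_linear_3:
  assumes "form_on V 3 \<rho>" "x \<in> V" "x' \<in> V" "y \<in> V" "w \<in> V"
  shows "\<rho> [c *\<^sub>R x + x', y, w] = c * \<rho> [x, y, w] + \<rho> [x', y, w]"
    and "\<rho> [y, c *\<^sub>R x + x', w] = c * \<rho> [y, x, w] + \<rho> [y, x', w]"
    and "\<rho> [y, w, c *\<^sub>R x + x'] = c * \<rho> [y, w, x] + \<rho> [y, w, x']"
  using form_on_linear[OF assms(1), of "[]" x "[y, w]" x' c]
    form_on_linear[OF assms(1), of "[y]" x "[w]" x' c]
    form_on_linear[OF assms(1), of "[y, w]" x "[]" x' c] assms(2-) by simp_all

lemma form_on_swap_3:
  assumes "subspace V" "form_on V 3 \<rho>" "x \<in> V" "y \<in> V" "w \<in> V"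
  shows "\<rho> [x, y, w] = - \<rho> [y, x, w]" and "\<rho> [x, y, w] = - \<rho> [x, w, y]"
  using form_on_swap[OF assms(1,2), of "[]" x y "[w]"]
    form_on_swap[OF assms(1,2), of "[x]" y w "[]"] assms(3-) by simp_all

lemma form_on_repeat_3:
  assumes "form_on V 3 \<rho>" "x \<in> V" "y \<in> V"
  shows "\<rho> [x, x, y] = 0" "\<rho> [x, y, x] = 0" "\<rho> [y, x, x] = 0"
  using assms by (auto intro!: form_on_not_distinct[OF assms(1)])

definition basis_list :: "'a::real_vector set \<Rightarrow> 'a list \<Rightarrow> bool" where
  "basis_list V e \<longleftrightarrow> distinct e \<and> independent (set e) \<and> span (set e) = V"

lemma basis_list_subset: "basis_list V e \<Longrightarrow> set e \<subseteq> V"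
  unfolding basis_list_def using span_superset by blast

lemma basis_list_subspace: "basis_list V e \<Longrightarrow> subspace V"
  unfolding basis_list_def by auto

text \<open>Writing the dimension as \<open>Suc n\<close> forces the extended basis to be finite: an
  infinite set would have cardinality 0.\<close>

lemma basis_list_extend:
  assumes "subspace V" "dim V = Suc n" "set us \<subseteq> V" "independent (set us)" "distinct us"
  obtains ws where "basis_list V (us @ ws)" "length (us @ ws) = Suc n"
proof -
  obtain B where B: "set us \<subseteq> B" "B \<subseteq> V" "independent B" "V \<subseteq> span B"
    using maximal_independent_subset_extend[OF assms(3,4)] by blast
  have "card B = Suc n" using basis_card_eq_dim[OF B(2,4,3)] assms(2) by simp
  then have fin: "finite B" by (simp add: card_ge_0_finite)
  then obtain ws where ws: "set ws = B - set us" "distinct ws"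
    using finite_distinct_list[of "B - set us"] by auto
  have eq: "set (us @ ws) = B" using ws B by auto
  have d: "distinct (us @ ws)" using ws assms(5) by auto
  have "span B = V" using B assms(1) by (simp add: span_subspace)
  then have "basis_list V (us @ ws)"
    using d B eq unfolding basis_list_def by simp
  moreover have "length (us @ ws) = Suc n" using distinct_card[OF d] eq \<open>card B = Suc n\<close> by simp
  ultimately show ?thesis using that by blast
qed

lemma basis_list_coordinate:
  assumes "basis_list V e" "b \<in> set e"
  obtains g :: "'a::real_vector \<Rightarrow> real" where "linear g" "g b = 1"
    "\<And>x. x \<in> set e \<Longrightarrow> x \<noteq> b \<Longrightarrow> g x = 0"
proof -
  obtain g where "linear g" "\<forall>x\<in>set e. g x = (if x = b then 1 else 0 :: real)"
    using linear_independent_extend[of "set e" "\<lambda>x. if x = b then 1 else 0 :: real"] assms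
    unfolding basis_list_def by blast
  then show ?thesis using that assms(2) by auto
qed

lemma volume_form6_basis:
  assumes "volume_form6 V \<Omega>" "basis_list V e" "length e = 6"
  shows "\<Omega> e \<noteq> 0"
  using assms form_on_eq_0_basis[of V 6 \<Omega> e]
  unfolding volume_form6_def form_eq_def basis_list_def by blast

section \<open>Kernels of contractions and the endomorphism \<open>S_rho\<close>\<close>

lemma subspace_interior_kernel:
  assumes V: "subspace V" and f: "form_on V 3 \<rho>" and v: "v \<in> V"
  shows "subspace {x \<in> V. \<forall>y\<in>V. interior v \<rho> [x, y] = 0}"
proof -
  have "\<rho> [v, 0, y] = 0" if "y \<in> V" for y
    using form_on_linear_3(2)[OF f, of 0 0 v y 1] V that v by (simp add: subspace_0)
  then show ?thesis
    using form_on_linear_3(2)[OF f _ _ v, of _ 0] V form_on_linear_3(2)[OF f _ _ v, of _ _ _ 1]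
    by (auto simp: subspace_def interior_def)
qed

text \<open>Rank four in dimension six leaves a two-dimensional kernel; it contains \<open>v\<close>
  by alternation, and \<open>u\<close> completes \<open>v\<close> to a basis of it.\<close>

lemma definite6_kernel:
  assumes "definite6 V \<rho>" "v \<in> V" "v \<noteq> 0"
  obtains u where "u \<in> V" "u \<notin> span {v}"
    "\<And>x. x \<in> V \<Longrightarrow> (\<forall>y\<in>V. \<rho> [v, x, y] = 0) \<longleftrightarrow> x \<in> span {v, u}"
proof -
  have V: "subspace V" and f: "form_on V 3 \<rho>" and d: "dim V = 6"
    and r: "rank2 V (interior v \<rho>) = 4"
    using assms unfolding definite6_def by auto
  define K where "K = {x \<in> V. \<forall>y\<in>V. interior v \<rho> [x, y] = 0}"
  have "dim K = 2" using r d unfolding rank2_def K_def by simp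
  have K: "subspace K" unfolding K_def using V f assms(2) by (rule subspace_interior_kernel)
  have "{v} \<subseteq> K" using form_on_repeat_3[OF f] assms(2) by (auto simp: K_def interior_def)
  moreover have "independent {v}" using assms(3) by simp
  moreover have "dim K = Suc 1" using \<open>dim K = 2\<close> by simp
  ultimately obtain ws where ws: "basis_list K ([v] @ ws)" "length ([v] @ ws) = Suc 1"
    using basis_list_extend[OF K, of 1 "[v]"] by auto
  then obtain u where "ws = [u]" by (auto simp: length_Suc_conv)
  then have "independent {u, v}" "u \<noteq> v" "span {v, u} = K"
    using ws unfolding basis_list_def by (auto simp: insert_commute)
  then have "u \<notin> span {v}" "u \<in> K"
    by (auto simp: independent_insert span_base)
  then show ?thesis
    using that[of u] \<open>span {v, u} = K\<close> by (auto simp: K_def interior_def)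
qed

text \<open>Expanding \<open>wedge 5 \<beta> \<eta>\<close> on the basis displays it as
  \<open>\<eta>\<close> applied to one explicit vector, which up to the factor
  \<open>\<Omega>\<close> is the value of \<open>S_rho\<close>. Both sides of the defining identity
  are 6-forms, so agreement on this basis suffices.\<close>

lemma S_rho_basis:
  assumes \<Omega>: "volume_form6 V \<Omega>" and \<rho>: "form_on V 3 \<rho>" and v: "v \<in> V"
    and e: "basis_list V [a, b, c, d, e, f]"
  defines "\<beta> \<equiv> wedge 2 (interior v \<rho>) \<rho>"
  shows "S_rho V \<Omega> \<rho> v = (1 / \<Omega> [a, b, c, d, e, f]) *\<^sub>R
    (\<beta> [a, b, c, d, e] *\<^sub>R f - \<beta> [a, b, c, d, f] *\<^sub>R e + \<beta> [a, b, c, e, f] *\<^sub>R d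
     - \<beta> [a, b, d, e, f] *\<^sub>R c + \<beta> [a, c, d, e, f] *\<^sub>R b - \<beta> [b, c, d, e, f] *\<^sub>R a)"
    (is "_ = ?w")
  unfolding S_rho_def \<beta>_def[symmetric]
proof (rule the_equality)
  let ?e = "[a, b, c, d, e, f]"
  have V: "subspace V" using e by (rule basis_list_subspace)
  have mem: "a \<in> V" "b \<in> V" "c \<in> V" "d \<in> V" "e \<in> V" "f \<in> V"
    using basis_list_subset[OF e] by auto
  have \<Omega>0: "\<Omega> ?e \<noteq> 0" using volume_form6_basis[OF \<Omega> e] by simp
  have w: "?w \<in> V" using mem V by (intro subspace_scale subspace_add subspace_diff)
  have eval: "wedge 5 \<beta> \<eta> ?e = \<eta> [?w] * \<Omega> ?e" if \<eta>: "form_on V 1 \<eta>" for \<eta>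
    using \<Omega>0 mem V
    by (simp add: wedge_5_6 form_on_1_linear[OF \<eta>] subspace_add subspace_diff subspace_scale)
  have "form_on V 2 (interior v \<rho>)" using form_on_interior[of V 2] \<rho> v by simp
  then have \<beta>: "form_on V 5 \<beta>"
    using form_on_wedge[OF V _ \<rho>, of 2] unfolding \<beta>_def by simp
  show "?w \<in> V \<and> (\<forall>\<eta>. form_on V 1 \<eta> \<longrightarrow>
      form_eq V 6 (wedge 5 \<beta> \<eta>) (\<lambda>vs. \<eta> [?w] * \<Omega> vs))"
    unfolding form_eq_def
  proof (intro conjI w allI impI ballI)
    fix \<eta> vs assume \<eta>: "form_on V 1 \<eta>" and vs: "vs \<in> tuples V 6"
    have "form_on V 6 (wedge 5 \<beta> \<eta>)" using form_on_wedge[OF V \<beta> \<eta>] by simp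
    then have "form_on V 6 (\<lambda>vs. wedge 5 \<beta> \<eta> vs - \<eta> [?w] * \<Omega> vs)"
      using \<Omega> unfolding volume_form6_def by (intro form_on_diff_scaled) auto
    from form_on_eq_0_basis[OF this _ _ _ _ vs, of ?e]
    show "wedge 5 \<beta> \<eta> vs = \<eta> [?w] * \<Omega> vs"
      using e eval[OF \<eta>] unfolding basis_list_def by simp
  qed
  fix w' assume *: "w' \<in> V \<and> (\<forall>\<eta>. form_on V 1 \<eta> \<longrightarrow>
      form_eq V 6 (wedge 5 \<beta> \<eta>) (\<lambda>vs. \<eta> [w'] * \<Omega> vs))"
  have "?e \<in> tuples V 6" using mem by simp
  then have "\<eta> [w'] * \<Omega> ?e = \<eta> [?w] * \<Omega> ?e" if "form_on V 1 \<eta>" for \<eta>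
    using * eval[OF that] that unfolding form_eq_def by metis
  then show "w' = ?w"
    using \<Omega>0 * w V by (intro form_on_1_separates[of V]) auto
qed

lemma S_rho_mem:
  assumes "volume_form6 V \<Omega>" "form_on V 3 \<rho>" "v \<in> V" "basis_list V [a, b, c, d, e, f]"
  shows "S_rho V \<Omega> \<rho> v \<in> V"
  using basis_list_subset[OF assms(4)] basis_list_subspace[OF assms(4)]
  unfolding S_rho_basis[OF assms]
  by (intro subspace_scale subspace_add subspace_diff) auto

text \<open>In the basis formula each coefficient depends on the argument only through its
  contraction with \<open>\<rho>\<close>, hence linearly.\<close>

lemma S_rho_linear:
  assumes \<Omega>: "volume_form6 V \<Omega>" and \<rho>: "form_on V 3 \<rho>" and xy: "x \<in> V" "y \<in> V"
    and e: "basis_list V [a, b, c, d, e, f]"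
  shows "S_rho V \<Omega> \<rho> (k *\<^sub>R x + y) = k *\<^sub>R S_rho V \<Omega> \<rho> x + S_rho V \<Omega> \<rho> y"
proof -
  have V: "subspace V" using e by (rule basis_list_subspace)
  have mem: "a \<in> V" "b \<in> V" "c \<in> V" "d \<in> V" "e \<in> V" "f \<in> V"
    using basis_list_subset[OF e] by auto
  have kxy: "k *\<^sub>R x + y \<in> V" using xy V by (simp add: subspace_add subspace_scale)
  have "wedge 2 (interior (k *\<^sub>R x + y) \<rho>) \<rho> [p, q, r, s, t] =
      k * wedge 2 (interior x \<rho>) \<rho> [p, q, r, s, t] + wedge 2 (interior y \<rho>) \<rho> [p, q, r, s, t]"
    if "p \<in> V" "q \<in> V" "r \<in> V" "s \<in> V" "t \<in> V" for p q r s t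
    using that xy
    by (simp add: wedge_2_5 interior_def form_on_linear_3[OF \<rho>]) (simp add: algebra_simps)
  then show ?thesis
    using mem unfolding S_rho_basis[OF \<Omega> \<rho> xy(1) e] S_rho_basis[OF \<Omega> \<rho> xy(2) e]
      S_rho_basis[OF \<Omega> \<rho> kxy e]
    by (simp add: algebra_simps add_divide_distrib)
qed

text \<open>\<open>\<Omega>\<close> enters the basis formula only as a divisor, so reversing the
  orientation reverses \<open>S_rho\<close>.\<close>

lemma S_rho_uminus:
  assumes "volume_form6 V \<Omega>" "form_on V 3 \<rho>" "v \<in> V" "basis_list V [a, b, c, d, e, f]"
  shows "volume_form6 V (\<lambda>vs. - \<Omega> vs)"
    and "S_rho V (\<lambda>vs. - \<Omega> vs) \<rho> v = - S_rho V \<Omega> \<rho> v"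
proof -
  show *: "volume_form6 V (\<lambda>vs. - \<Omega> vs)"
    using assms(1) unfolding volume_form6_def form_eq_def form_on_def by simp
  show "S_rho V (\<lambda>vs. - \<Omega> vs) \<rho> v = - S_rho V \<Omega> \<rho> v"
    unfolding S_rho_basis[OF assms] S_rho_basis[OF * assms(2-4)] by (simp del: scaleR_minus_left add: scaleR_minus_left[symmetric])
qed

text \<open>A coefficient whose list contains both \<open>v\<close> and \<open>u\<close> vanishes:
  one of them meets \<open>interior v \<rho>\<close>, or both meet \<open>\<rho>\<close>. In the two
  remaining coefficients the single \<open>v\<close> or \<open>u\<close> must be fed to the factor
  \<open>\<rho>\<close>.\<close>

lemma S_rho_adapted:
  assumes \<Omega>: "volume_form6 V \<Omega>" and \<rho>: "form_on V 3 \<rho>"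
    and e: "basis_list V [v, u, a, b, c, d]"
    and u: "\<And>y. y \<in> V \<Longrightarrow> \<rho> [v, u, y] = 0"
  shows "S_rho V \<Omega> \<rho> v =
    (wedge 2 (interior v \<rho>) (interior v \<rho>) [a, b, c, d] / \<Omega> [v, u, a, b, c, d]) *\<^sub>R u
    - (wedge 2 (interior v \<rho>) (interior u \<rho>) [a, b, c, d] / \<Omega> [v, u, a, b, c, d]) *\<^sub>R v"
proof -
  have V: "subspace V" using e by (rule basis_list_subspace)
  have mem: "v \<in> V" "u \<in> V" "a \<in> V" "b \<in> V" "c \<in> V" "d \<in> V"
    using basis_list_subset[OF e] by auto
  let ?\<beta> = "wedge 2 (interior v \<rho>) \<rho>"
  have 0: "?\<beta> [v, u, p, q, r] = 0" if "p \<in> V" "q \<in> V" "r \<in> V" for p q r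
    using that mem by (simp add: wedge_2_5 interior_def u form_on_repeat_3[OF \<rho>])
  have 1: "?\<beta> [v, a, b, c, d] = wedge 2 (interior v \<rho>) (interior v \<rho>) [a, b, c, d]"
    using mem by (simp add: wedge_2_5 wedge_2_4 interior_def form_on_repeat_3[OF \<rho>])
  have 2: "?\<beta> [u, a, b, c, d] = wedge 2 (interior v \<rho>) (interior u \<rho>) [a, b, c, d]"
    using mem by (simp add: wedge_2_5 wedge_2_4 interior_def u)
  show ?thesis
    unfolding S_rho_basis[OF \<Omega> \<rho> mem(1) e] using mem
    by (simp add: 0 1 2 scaleR_diff_right)
qed

text \<open>Up to a factor 2 the quantity below is the Pfaffian of \<open>interior v \<rho>\<close> on the quotient of
  \<open>V\<close> by the kernel; if it vanished, then \<open>\<sigma>(c,d) b - \<sigma>(b,d) c + \<sigma>(b,c) d\<close> would lie in the kernel.\<close>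

lemma definite6_wedge_interior_neq_0:
  assumes \<rho>: "definite6 V \<rho>" and e: "basis_list V [v, u, a, b, c, d]"
    and u: "\<And>y. y \<in> V \<Longrightarrow> \<rho> [v, u, y] = 0"
  shows "wedge 2 (interior v \<rho>) (interior v \<rho>) [a, b, c, d] \<noteq> 0"
proof
  assume zero: "wedge 2 (interior v \<rho>) (interior v \<rho>) [a, b, c, d] = 0"
  have V: "subspace V" and f: "form_on V 3 \<rho>"
    using \<rho> unfolding definite6_def by auto
  have dist: "distinct [v, u, a, b, c, d]" and ind: "independent {v, u, a, b, c, d}"
    and sp: "span {v, u, a, b, c, d} = V"
    using e unfolding basis_list_def by auto
  have mem: "v \<in> V" "u \<in> V" "a \<in> V" "b \<in> V" "c \<in> V" "d \<in> V"
    using basis_list_subset[OF e] by auto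
  have v0: "v \<noteq> 0" using ind dependent_zero by blast
  define \<sigma> where "\<sigma> = (\<lambda>x y. \<rho> [v, x, y])"
  have skew: "\<sigma> x y = - \<sigma> y x" if "x \<in> V" "y \<in> V" for x y
    unfolding \<sigma>_def by (rule form_on_swap_3(2)[OF V f mem(1) that])
  have lin: "\<sigma> (p *\<^sub>R x + y) w = p * \<sigma> x w + \<sigma> y w" if "x \<in> V" "y \<in> V" "w \<in> V" for p x y w
    unfolding \<sigma>_def using form_on_linear_3(2)[OF f that(1,2) mem(1) that(3)] .
  obtain u' where "u' \<notin> span {v}"
    and u': "\<And>x. x \<in> V \<Longrightarrow> (\<forall>y\<in>V. \<rho> [v, x, y] = 0) \<longleftrightarrow> x \<in> span {v, u'}"
    using definite6_kernel[OF \<rho> mem(1) v0] by blast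
  have "u \<in> span {v, u'}" using u u' mem by blast
  moreover have "u \<notin> span {v}"
    using independent_mono[OF ind, of "{u, v}"] dist by (auto simp: independent_insert split: if_splits)
  ultimately have "u' \<in> span {u, v}"
    using in_span_insert[of u u' "{v}"] by (simp add: insert_commute)
  \<comment> \<open>By exchange \<open>u\<close> replaces \<open>u'\<close>, so \<open>v\<close> and
    \<open>u\<close> already span the kernel.\<close>
  then have ker: "x \<in> span {v, u}" if "x \<in> V" "\<And>y. y \<in> V \<Longrightarrow> \<sigma> x y = 0" for x
  proof -
    have "span {v, u'} \<subseteq> span {v, u}"
      using \<open>u' \<in> span {u, v}\<close> by (intro span_minimal) (auto simp: span_base insert_commute)
    then show ?thesis using u' that unfolding \<sigma>_def by blast
  qed
  \<comment> \<open>A combination of \<open>b\<close>, \<open>c\<close>, \<open>d\<close> that pairs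
    to zero with \<open>a\<close>, \<open>b\<close>, \<open>c\<close>, \<open>d\<close> also does so
    with \<open>v\<close> and \<open>u\<close>. It thus lies in the kernel, spanned by
    \<open>v\<close> and \<open>u\<close>, and independence of the basis kills its
    coefficients.\<close>
  have coeffs: "p = 0 \<and> q = 0 \<and> r = 0"
    if x: "x = p *\<^sub>R b + (q *\<^sub>R c + r *\<^sub>R d)"
      and z: "\<sigma> x a = 0" "\<sigma> x b = 0" "\<sigma> x c = 0" "\<sigma> x d = 0" for p q r x
  proof -
    have xV: "x \<in> V" using mem V unfolding x by (simp add: subspace_add subspace_scale)
    have "\<sigma> x y = 0" if "y \<in> V" for y
    proof -
      have i: "form_on (span (set [v, u, a, b, c, d])) 1 (interior x (interior v \<rho>))"
        using form_on_interior[of V 2 \<rho> v] form_on_interior[of V 1 "interior v \<rho>" x] f mem xV sp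
        by (simp add: numeral_eq_Suc)
      have "interior x (interior v \<rho>) vs = 0" if vs: "vs \<in> tuples (set [v, u, a, b, c, d]) 1" for vs
      proof -
        obtain y where "vs = [y]" "y \<in> {v, u, a, b, c, d}"
          using vs by (auto simp: tuples_def length_Suc_conv)
        moreover have "\<sigma> x v = 0" "\<sigma> x u = 0"
          using skew[OF xV] mem xV by (auto simp: \<sigma>_def u form_on_repeat_3[OF f])
        ultimately show ?thesis using z by (auto simp: interior_def \<sigma>_def)
      qed
      from form_on_eq_0_span[OF i this, of "[y]"]
      show ?thesis using sp that by (simp add: interior_def \<sigma>_def)
    qed
    then have xs: "x \<in> span {v, u}" using ker xV by blast
    have g0: "g x = 0" if "linear g" "g v = 0" "g u = 0" for g :: "'a \<Rightarrow> real"
      using linear_eq_0_on_span[OF that(1), of "{v, u}"] xs that by auto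
    have bcd: "b \<in> set [v, u, a, b, c, d]" "c \<in> set [v, u, a, b, c, d]" "d \<in> set [v, u, a, b, c, d]"
      by simp_all
    obtain g1 :: "'a \<Rightarrow> real" where g1: "linear g1" "g1 b = 1" "\<And>y. y \<in> set [v, u, a, b, c, d] \<Longrightarrow> y \<noteq> b \<Longrightarrow> g1 y = 0"
      using basis_list_coordinate[OF e bcd(1)] by blast
    obtain g2 :: "'a \<Rightarrow> real" where g2: "linear g2" "g2 c = 1" "\<And>y. y \<in> set [v, u, a, b, c, d] \<Longrightarrow> y \<noteq> c \<Longrightarrow> g2 y = 0"
      using basis_list_coordinate[OF e bcd(2)] by blast
    obtain g3 :: "'a \<Rightarrow> real" where g3: "linear g3" "g3 d = 1" "\<And>y. y \<in> set [v, u, a, b, c, d] \<Longrightarrow> y \<noteq> d \<Longrightarrow> g3 y = 0"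
      using basis_list_coordinate[OF e bcd(3)] by blast
    have z1: "g1 v = 0" "g1 u = 0" "g1 c = 0" "g1 d = 0" by (rule g1(3), use dist in auto)+
    have z2: "g2 v = 0" "g2 u = 0" "g2 b = 0" "g2 d = 0" by (rule g2(3), use dist in auto)+
    have z3: "g3 v = 0" "g3 u = 0" "g3 b = 0" "g3 c = 0" by (rule g3(3), use dist in auto)+
    have "g1 x = p" "g2 x = q" "g3 x = r"
      using g1(1,2) g2(1,2) g3(1,2) unfolding x
      by (simp_all add: linear_add linear_scale z1 z2 z3)
    moreover have "g1 x = 0" "g2 x = 0" "g3 x = 0"
      using g0[OF g1(1)] g0[OF g2(1)] g0[OF g3(1)] z1 z2 z3 by blast+
    ultimately show ?thesis by simp
  qed
  have self: "\<sigma> x x = 0" if "x \<in> V" for x using form_on_repeat_3[OF f] mem that by (simp add: \<sigma>_def)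
  have pf: "\<sigma> a b * \<sigma> c d - \<sigma> a c * \<sigma> b d + \<sigma> a d * \<sigma> b c = 0"
    using zero unfolding wedge_2_4 interior_def \<sigma>_def by simp
  have lin3: "\<sigma> (p *\<^sub>R b + (q *\<^sub>R c + r *\<^sub>R d)) y = p * \<sigma> b y + q * \<sigma> c y + r * \<sigma> d y"
    if "y \<in> V" for p q r y
    using lin[of b "q *\<^sub>R c + r *\<^sub>R d" y p] lin[of c "r *\<^sub>R d" y q] lin[of d 0 y r]
      lin[of 0 0 y 1] mem V that
    by (simp add: subspace_add subspace_scale subspace_0)
  have coeffs': "p = 0 \<and> q = 0 \<and> r = 0"
    if "\<And>y. y \<in> {a, b, c, d} \<Longrightarrow> p * \<sigma> b y + q * \<sigma> c y + r * \<sigma> d y = 0" for p q r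
    by (rule coeffs[OF refl]) (simp_all add: lin3 mem that)
  note sk = skew[OF mem(4,3)] skew[OF mem(5,3)] skew[OF mem(6,3)] skew[OF mem(5,4)]
    skew[OF mem(6,4)] skew[OF mem(6,5)]
  \<comment> \<open>Three kernel vectors in turn. The first pairs with \<open>a\<close> to minus the
    vanishing Pfaffian and with \<open>b\<close>, \<open>c\<close>, \<open>d\<close> to zero
    identically. Once its coefficients vanish, \<open>\<sigma> c a\<close> and
    \<open>- \<sigma> b a\<close> are the coefficients of the second. The third is \<open>b\<close>
    itself, whose coefficient 1 is the contradiction.\<close>
  have 1: "\<sigma> c d = 0 \<and> - \<sigma> b d = 0 \<and> \<sigma> b c = 0"
    using pf by (intro coeffs') (auto simp: mem self sk algebra_simps)
  then have 2: "\<sigma> c a = 0 \<and> - \<sigma> b a = 0 \<and> 0 = (0::real)"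
    by (intro coeffs') (auto simp: mem self sk)
  from 1 2 have "(1::real) = 0 \<and> (0::real) = 0 \<and> (0::real) = 0"
    by (intro coeffs') (auto simp: mem self sk)
  then show False by simp
qed

lemma basis_list_extend_pair:
  assumes "subspace V" "dim V = 6" "v \<in> V" "u \<in> V" "v \<noteq> 0" "u \<notin> span {v}"
  obtains a b c d where "basis_list V [v, u, a, b, c, d]"
proof -
  have "u \<noteq> v" using assms(6) by (metis singletonI span_base)
  then have "independent (set [v, u])"
    using assms(5,6) by (simp add: insert_commute independent_insert)
  then obtain ws where ws: "basis_list V ([v, u] @ ws)" "length ([v, u] @ ws) = Suc 5"
    using basis_list_extend[of V 5 "[v, u]"] assms \<open>u \<noteq> v\<close> by auto
  then obtain a b c d where "ws = [a, b, c, d]"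
    by (auto simp: length_Suc_conv numeral_eq_Suc)
  then show ?thesis using ws that by simp
qed

lemma basis_list_6:
  assumes "subspace V" "dim V = 6"
  obtains a b c d e f where "basis_list V [a, b, c, d, e, f]"
proof -
  obtain ws where ws: "basis_list V ([] @ ws)" "length ([] @ ws) = Suc 5"
    using basis_list_extend[of V 5 "[]"] assms by (auto simp: independent_empty)
  then obtain a b c d e f where "ws = [a, b, c, d, e, f]"
    by (auto simp: length_Suc_conv numeral_eq_Suc)
  then show ?thesis using ws that by simp
qed

lemma scaleR_mem_spanD: "k *\<^sub>R x \<in> span S \<Longrightarrow> k \<noteq> 0 \<Longrightarrow> x \<in> span S"
  using span_scale[of "k *\<^sub>R x" S "1 / k"] by simp

lemma basis_list_nonzero: "basis_list V e \<Longrightarrow> v \<in> set e \<Longrightarrow> v \<noteq> 0"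
  unfolding basis_list_def using dependent_zero by blast

lemma exists_volume_form6:
  assumes "definite6 V \<rho>"
  obtains \<Omega> where "volume_form6 V \<Omega>"
proof -
  have V: "subspace V" "dim V = 6" and f: "form_on V 3 \<rho>"
    using assms unfolding definite6_def by auto
  obtain v where v: "v \<in> V" "v \<noteq> 0"
    using basis_list_6[OF V] basis_list_subset basis_list_nonzero
    by (metis list.set_intros(1) subsetD)
  obtain u where u: "u \<in> V" "u \<notin> span {v}"
    and ker: "\<And>x. x \<in> V \<Longrightarrow> (\<forall>y\<in>V. \<rho> [v, x, y] = 0) \<longleftrightarrow> x \<in> span {v, u}"
    using definite6_kernel[OF assms v] by blast
  have vu: "\<rho> [v, u, y] = 0" if "y \<in> V" for y
    using ker[OF u(1)] that by (simp add: span_base)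
  obtain a b c d where e: "basis_list V [v, u, a, b, c, d]"
    using basis_list_extend_pair[OF V v(1) u(1) v(2) u(2)] .
  have mem: "a \<in> V" "b \<in> V" "c \<in> V" "d \<in> V" using basis_list_subset[OF e] by auto
  obtain g :: "'a \<Rightarrow> real" where g: "linear g" "g u = 1"
    "\<And>y. y \<in> set [v, u, a, b, c, d] \<Longrightarrow> y \<noteq> u \<Longrightarrow> g y = 0"
    using basis_list_coordinate[OF e, of u] by auto
  have "distinct [v, u, a, b, c, d]" using e unfolding basis_list_def by simp
  then have g0: "g v = 0" "g a = 0" "g b = 0" "g c = 0" "g d = 0" using g(3) by auto
  \<comment> \<open>\<open>g\<close> is the coordinate of \<open>u\<close>, so on the basis only the
    term omitting \<open>u\<close> from the 5-form survives, and this is the nonzero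
    Pfaffian.\<close>
  define \<Omega> where "\<Omega> = wedge 5 (wedge 2 (interior v \<rho>) \<rho>) (\<lambda>vs. g (hd vs))"
  have "form_on V 2 (interior v \<rho>)" using form_on_interior[of V 2] f v by simp
  then have "form_on V 5 (wedge 2 (interior v \<rho>) \<rho>)"
    using form_on_wedge[OF V(1) _ f, of 2] by simp
  then have "form_on V 6 \<Omega>"
    using form_on_wedge[OF V(1) _ form_on_1I[OF g(1)], of 5] unfolding \<Omega>_def by simp
  moreover have "\<Omega> [v, u, a, b, c, d] = wedge 2 (interior v \<rho>) (interior v \<rho>) [a, b, c, d]"
    unfolding \<Omega>_def wedge_5_6 using v mem
    by (simp add: g g0 wedge_2_5 wedge_2_4 interior_def form_on_repeat_3[OF f])
  then have "\<Omega> [v, u, a, b, c, d] \<noteq> 0"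
    using definite6_wedge_interior_neq_0[OF assms e vu] by simp
  moreover have "[v, u, a, b, c, d] \<in> tuples V 6" using v u mem by simp
  ultimately have "volume_form6 V \<Omega>"
    unfolding volume_form6_def form_eq_def by blast
  then show ?thesis by (rule that)
qed

text \<open>In an adapted basis the value is \<open>A *\<^sub>R u - B *\<^sub>R v\<close>, where
  \<open>A\<close> is the Pfaffian divided by the volume and hence nonzero.\<close>

lemma S_rho_kernel:
  assumes \<rho>: "definite6 V \<rho>" and \<Omega>: "volume_form6 V \<Omega>" and v: "v \<in> V" "v \<noteq> 0"
  shows "S_rho V \<Omega> \<rho> v \<in> V" "S_rho V \<Omega> \<rho> v \<notin> span {v}"
    and "\<And>y. y \<in> V \<Longrightarrow> \<rho> [v, S_rho V \<Omega> \<rho> v, y] = 0"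
proof -
  have V: "subspace V" "dim V = 6" and f: "form_on V 3 \<rho>"
    using \<rho> unfolding definite6_def by auto
  obtain u where u: "u \<in> V" "u \<notin> span {v}"
    and ker: "\<And>x. x \<in> V \<Longrightarrow> (\<forall>y\<in>V. \<rho> [v, x, y] = 0) \<longleftrightarrow> x \<in> span {v, u}"
    using definite6_kernel[OF \<rho> v] by blast
  have vu: "\<rho> [v, u, y] = 0" if "y \<in> V" for y
    using ker[OF u(1)] that by (simp add: span_base)
  obtain a b c d where e: "basis_list V [v, u, a, b, c, d]"
    using basis_list_extend_pair[OF V v(1) u(1) v(2) u(2)] .
  define A where "A = wedge 2 (interior v \<rho>) (interior v \<rho>) [a, b, c, d] / \<Omega> [v, u, a, b, c, d]"
  define B where "B = wedge 2 (interior v \<rho>) (interior u \<rho>) [a, b, c, d] / \<Omega> [v, u, a, b, c, d]"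
  have S: "S_rho V \<Omega> \<rho> v = A *\<^sub>R u - B *\<^sub>R v"
    unfolding A_def B_def by (rule S_rho_adapted[OF \<Omega> f e vu])
  have A: "A \<noteq> 0"
    using definite6_wedge_interior_neq_0[OF \<rho> e vu] volume_form6_basis[OF \<Omega> e] by (simp add: A_def)
  show SV: "S_rho V \<Omega> \<rho> v \<in> V" unfolding S using u v V by (simp add: subspace_diff subspace_scale)
  have "S_rho V \<Omega> \<rho> v \<in> span {v, u}"
    unfolding S by (intro span_diff span_scale span_base) auto
  then show "\<rho> [v, S_rho V \<Omega> \<rho> v, y] = 0" if "y \<in> V" for y using ker[OF SV] that by blast
  show "S_rho V \<Omega> \<rho> v \<notin> span {v}"
  proof
    assume "S_rho V \<Omega> \<rho> v \<in> span {v}"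
    then have "(1 / A) *\<^sub>R (S_rho V \<Omega> \<rho> v + B *\<^sub>R v) \<in> span {v}"
      by (intro span_scale span_add) (auto simp: span_base)
    then show False using A u(2) by (simp add: S)
  qed
qed

text \<open>In the basis \<open>v, u = S v, a, b, c, d\<close> the coefficient of \<open>v\<close> in \<open>S v\<close> is a multiple of
  \<open>(\<iota>\<^sub>v\<rho> \<and> \<iota>\<^sub>u\<rho>)(a,b,c,d)\<close>, which must therefore vanish. By symmetry of this expression in \<open>u\<close> and \<open>v\<close>
  the coefficient of \<open>u\<close> in \<open>S u\<close> vanishes too, so that \<open>S (S v)\<close> is a multiple of \<open>v\<close>.\<close>

lemma S_rho_square_eigenvector:
  assumes \<rho>: "definite6 V \<rho>" and \<Omega>: "volume_form6 V \<Omega>" and v: "v \<in> V" "v \<noteq> 0"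
  obtains p where "p \<noteq> 0" "S_rho V \<Omega> \<rho> (S_rho V \<Omega> \<rho> v) = p *\<^sub>R v"
proof -
  have V: "subspace V" "dim V = 6" and f: "form_on V 3 \<rho>"
    using \<rho> unfolding definite6_def by auto
  define u where "u = S_rho V \<Omega> \<rho> v"
  have u: "u \<in> V" "u \<notin> span {v}" and vu: "\<rho> [v, u, y] = 0" if "y \<in> V" for y
    using S_rho_kernel[OF assms] that unfolding u_def by blast+
  have uV: "u \<in> V" "u \<notin> span {v}" using u(1,2)[OF v(1)] by auto
  obtain a b c d where e: "basis_list V [v, u, a, b, c, d]"
    using basis_list_extend_pair[OF V v(1) uV(1) v(2) uV(2)] .
  define M where "M = (\<lambda>x y. wedge 2 (interior x \<rho>) (interior y \<rho>) [a, b, c, d])"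
  have M: "M u v = M v u" by (simp add: M_def wedge_2_4 mult.commute)
  let ?e = "[v, u, a, b, c, d]" and ?e' = "[u, v, a, b, c, d]"
  have \<Omega>0: "\<Omega> ?e \<noteq> 0" using volume_form6_basis[OF \<Omega> e] by simp
  have eq: "u = (M v v / \<Omega> ?e) *\<^sub>R u - (M v u / \<Omega> ?e) *\<^sub>R v"
    using S_rho_adapted[OF \<Omega> f e vu] unfolding M_def u_def[symmetric] .
  \<comment> \<open>As \<open>u\<close> is no multiple of \<open>v\<close>, both coefficients in
    this relation are zero.\<close>
  have lin: "(1 - M v v / \<Omega> ?e) *\<^sub>R u = - (M v u / \<Omega> ?e) *\<^sub>R v"
    using arg_cong[OF eq, of "\<lambda>x. x - (M v v / \<Omega> ?e) *\<^sub>R u"] by (simp add: scaleR_diff_left)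
  have "1 - M v v / \<Omega> ?e = 0"
  proof (rule ccontr)
    assume n: "1 - M v v / \<Omega> ?e \<noteq> 0"
    have "(1 - M v v / \<Omega> ?e) *\<^sub>R u \<in> span {v}"
      unfolding lin by (intro span_scale span_base) simp
    from scaleR_mem_spanD[OF this n] show False using uV by blast
  qed
  then have "M v u = 0" using lin v \<Omega>0 by simp
  \<comment> \<open>Exchanging the first two vectors gives a basis adapted to \<open>u\<close>; the
    coefficient of \<open>u\<close> is then \<open>M u v\<close>, equal to \<open>M v u\<close>
    because 2-forms commute, and so zero.\<close>
  have e': "basis_list V ?e'" using e unfolding basis_list_def by (auto simp: insert_commute)
  have uv: "\<rho> [u, v, y] = 0" if "y \<in> V" for y
    using vu[OF that] form_on_swap_3(1)[OF V(1) f uV(1) v(1) that] by simp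
  have "S_rho V \<Omega> \<rho> u = (M u u / \<Omega> ?e') *\<^sub>R v"
    using S_rho_adapted[OF \<Omega> f e' uv] \<open>M v u = 0\<close> M unfolding M_def by simp
  moreover have "M u u / \<Omega> ?e' \<noteq> 0"
    using definite6_wedge_interior_neq_0[OF \<rho> e' uv] volume_form6_basis[OF \<Omega> e']
    unfolding M_def by simp
  ultimately show ?thesis using that unfolding u_def by blast
qed

text \<open>A linear map with every nonzero vector an eigenvector is scalar: for \<open>v\<close>
  independent of \<open>a\<close>, the eigenvalues at \<open>v\<close>, \<open>a\<close> and
  \<open>v + a\<close> coincide.\<close>

lemma S_rho_square:
  assumes \<rho>: "definite6 V \<rho>" and \<Omega>: "volume_form6 V \<Omega>"
  obtains p where "p \<noteq> 0" "\<And>v. v \<in> V \<Longrightarrow> S_rho V \<Omega> \<rho> (S_rho V \<Omega> \<rho> v) = p *\<^sub>R v"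
proof -
  let ?S = "S_rho V \<Omega> \<rho>"
  have V: "subspace V" "dim V = 6" and f: "form_on V 3 \<rho>"
    using \<rho> unfolding definite6_def by auto
  obtain a b c d e g where bl: "basis_list V [a, b, c, d, e, g]"
    using basis_list_6[OF V] .
  have a: "a \<in> V" "a \<noteq> 0" using basis_list_subset[OF bl] basis_list_nonzero[OF bl] by auto
  have mem: "?S x \<in> V" if "x \<in> V" for x using S_rho_mem[OF \<Omega> f that bl] .
  have S: "?S (k *\<^sub>R x + y) = k *\<^sub>R ?S x + ?S y" if "x \<in> V" "y \<in> V" for k x y
    using S_rho_linear[OF \<Omega> f that bl] .
  have SS: "?S (?S (k *\<^sub>R x + y)) = k *\<^sub>R ?S (?S x) + ?S (?S y)" if "x \<in> V" "y \<in> V" for k x y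
    using that by (simp add: S mem)
  have SS0: "?S (?S 0) = 0" using SS[of 0 0 1] V by (simp add: subspace_0)
  obtain p where p: "p \<noteq> 0" "?S (?S a) = p *\<^sub>R a"
    using S_rho_square_eigenvector[OF \<rho> \<Omega> a] .
  have "?S (?S v) = p *\<^sub>R v" if v: "v \<in> V" for v
  proof (cases "v \<in> span {a}")
    case True
    then obtain k where "v = k *\<^sub>R a" by (auto simp: span_singleton)
    then show ?thesis using SS[OF a(1), of 0 k] p SS0 V by (simp add: subspace_0)
  next
    case False
    have v0: "v \<noteq> 0" using False span_zero by auto
    have "v + a \<noteq> 0" using False span_neg[of a "{a}"] by (auto simp: add_eq_0_iff2 span_base)
    then obtain q where q: "?S (?S (v + a)) = q *\<^sub>R (v + a)"
      using S_rho_square_eigenvector[OF \<rho> \<Omega>, of "v + a"] a v V by (auto simp: subspace_add)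
    obtain r where r: "?S (?S v) = r *\<^sub>R v"
      using S_rho_square_eigenvector[OF \<rho> \<Omega> v v0] .
    have "q *\<^sub>R (v + a) = r *\<^sub>R v + p *\<^sub>R a" using SS[OF v a(1), of 1] q r p by simp
    then have lin: "(q - r) *\<^sub>R v = (p - q) *\<^sub>R a" by (simp add: algebra_simps)
    have "q = r"
    proof (rule ccontr)
      assume "q \<noteq> r"
      have "(q - r) *\<^sub>R v \<in> span {a}" unfolding lin by (intro span_scale span_base) simp
      from scaleR_mem_spanD[OF this] show False using \<open>q \<noteq> r\<close> False by simp
    qed
    then show ?thesis using lin a r by simp
  qed
  then show ?thesis using that p by blast
qed

text \<open>Evaluation at a nonzero vector identifies \<open>P_rho\<close> with the nonzero scalar
  of \<open>S_rho_square\<close>; \<open>powr\<close> is positive at every nonzero base, so the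
  normalizing factor is positive.\<close>

lemma J_rho_positive_multiple:
  assumes \<rho>: "definite6 V \<rho>" and \<Omega>: "volume_form6 V \<Omega>"
  obtains k where "k > 0" "\<And>v. J_rho V \<Omega> \<rho> v = k *\<^sub>R S_rho V \<Omega> \<rho> v"
proof -
  have V: "subspace V" "dim V = 6" using \<rho> unfolding definite6_def by auto
  obtain p where p: "p \<noteq> 0" "\<And>v. v \<in> V \<Longrightarrow> S_rho V \<Omega> \<rho> (S_rho V \<Omega> \<rho> v) = p *\<^sub>R v"
    using S_rho_square[OF assms] by blast
  obtain a where a: "a \<in> V" "a \<noteq> 0"
    using basis_list_6[OF V] basis_list_subset basis_list_nonzero
    by (metis list.set_intros(1) subsetD)
  have "P_rho V \<Omega> \<rho> = p"
    unfolding P_rho_def using p a by (intro the_equality) (auto dest!: bspec[OF _ a(1)])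
  then show ?thesis
    using that[of "(- p) powr (- 1 / 2)"] p by (simp add: J_rho_def)
qed

section \<open>Constancy of sign and the choice of orientation\<close>

text \<open>If \<open>q v < 0 < q u\<close>, then \<open>q\<close> has a zero on the line
  \<open>u + t *\<^sub>R v\<close>. This forces \<open>u\<close> to be a multiple of
  \<open>v\<close>, and then \<open>q u\<close> cannot be positive.\<close>

lemma anisotropic_quadratic_sign:
  fixes q :: "'a::real_vector \<Rightarrow> real"
  assumes "subspace V"
    and q: "\<And>u v t. u \<in> V \<Longrightarrow> v \<in> V \<Longrightarrow> q (u + t *\<^sub>R v) = q u + t * b u v + t\<^sup>2 * q v"
    and scale: "\<And>v t. v \<in> V \<Longrightarrow> q (t *\<^sub>R v) = t\<^sup>2 * q v"
    and nz: "\<And>v. v \<in> V \<Longrightarrow> v \<noteq> 0 \<Longrightarrow> q v \<noteq> 0"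
    and uv: "u \<in> V" "v \<in> V" "u \<noteq> 0" "v \<noteq> 0" "q u > 0"
  shows "q v > 0"
proof (rule ccontr)
  assume "\<not> q v > 0"
  then have neg: "q v < 0" using nz[OF uv(2,4)] by simp
  \<comment> \<open>Quadratic formula for \<open>q (u + t *\<^sub>R v) = 0\<close>; the discriminant
    is positive because \<open>q u\<close> and \<open>q v\<close> have opposite signs.\<close>
  define s where "s = sqrt ((b u v)\<^sup>2 - 4 * q v * q u)"
  define t where "t = (s - b u v) / (2 * q v)"
  have "q v * q u < 0" using neg uv(5) by (simp add: mult_neg_pos)
  then have s: "s\<^sup>2 = (b u v)\<^sup>2 - 4 * q v * q u"
    using zero_le_power2[of "b u v"] unfolding s_def by (intro real_sqrt_pow2) linarith
  have "s = 2 * q v * t + b u v" using neg by (simp add: t_def)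
  then have "4 * q v * (q u + t * b u v + t\<^sup>2 * q v) = 0"
    using s by (simp add: power2_eq_square algebra_simps)
  then have "q (u + t *\<^sub>R v) = 0" using neg q[OF uv(1,2)] by simp
  then have "u + t *\<^sub>R v = 0"
    using nz[of "u + t *\<^sub>R v"] uv assms(1) by (meson subspace_add subspace_scale)
  then have "u = (- t) *\<^sub>R v" by (simp add: add_eq_0_iff2)
  then have "q u = t\<^sup>2 * q v" using scale[OF uv(2), of "- t"] by simp
  moreover have "t\<^sup>2 * q v \<le> 0" using neg by (simp add: mult_nonneg_nonpos)
  ultimately show False using uv(5) by simp
qed

text \<open>Hypothesis \<open>nz\<close> is the input from dimension seven: \<open>\<omega>\<close>
  is nonzero on any basis \<open>v\<close>, \<open>u\<close> of the kernel of
  \<open>interior v \<rho>\<close>. It makes \<open>\<omega> [v, S v]\<close> a quadratic form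
  without nontrivial zeros.\<close>

lemma exists_taming_orientation:
  assumes \<rho>: "definite6 V \<rho>" and \<omega>: "form_on V 2 \<omega>"
    and nz: "\<And>v u. v \<in> V \<Longrightarrow> v \<noteq> 0 \<Longrightarrow> u \<in> V \<Longrightarrow> u \<notin> span {v} \<Longrightarrow>
      (\<And>y. y \<in> V \<Longrightarrow> \<rho> [v, u, y] = 0) \<Longrightarrow> \<omega> [v, u] \<noteq> 0"
  obtains \<Omega> where "volume_form6 V \<Omega>" "taming_on V \<omega> (J_rho V \<Omega> \<rho>)"
proof -
  have V: "subspace V" "dim V = 6" and f: "form_on V 3 \<rho>"
    using \<rho> unfolding definite6_def by auto
  obtain \<Omega> where \<Omega>: "volume_form6 V \<Omega>" using exists_volume_form6[OF \<rho>] .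
  let ?S = "S_rho V \<Omega> \<rho>"
  obtain a b c d e g where bl: "basis_list V [a, b, c, d, e, g]"
    using basis_list_6[OF V] .
  have a: "a \<in> V" "a \<noteq> 0" using basis_list_subset[OF bl] basis_list_nonzero[OF bl] by auto
  have mem: "?S x \<in> V" if "x \<in> V" for x using S_rho_mem[OF \<Omega> f that bl] .
  have S: "?S (k *\<^sub>R x + y) = k *\<^sub>R ?S x + ?S y" if "x \<in> V" "y \<in> V" for k x y
    using S_rho_linear[OF \<Omega> f that bl] .
  have 0: "0 \<in> V" using V by (simp add: subspace_0)
  have S_scale: "?S (k *\<^sub>R x) = k *\<^sub>R ?S x" if "x \<in> V" for k x
    using S[OF that 0, of k] S[OF 0 0, of 1] by simp
  have l1: "\<omega> [k *\<^sub>R x + y, w] = k * \<omega> [x, w] + \<omega> [y, w]"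
    and l2: "\<omega> [w, k *\<^sub>R x + y] = k * \<omega> [w, x] + \<omega> [w, y]"
    if "x \<in> V" "y \<in> V" "w \<in> V" for k x y w
    using form_on_linear[OF \<omega>, of "[]" x "[w]" y k] form_on_linear[OF \<omega>, of "[w]" x "[]" y k] that
    by simp_all
  have z: "\<omega> [0, w] = 0" "\<omega> [w, 0] = 0" if "w \<in> V" for w
    using l1[OF 0 0 that, of 1] l2[OF 0 0 that, of 1] by simp_all
  have s1: "\<omega> [k *\<^sub>R x, w] = k * \<omega> [x, w]" and s2: "\<omega> [w, k *\<^sub>R x] = k * \<omega> [w, x]"
    if "x \<in> V" "w \<in> V" for k x w
    using l1[OF that(1) 0 that(2), of k] l2[OF that(1) 0 that(2), of k] z that by simp_all
  define q where "q = (\<lambda>v. \<omega> [v, ?S v])"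
  have sub: "k *\<^sub>R x + y \<in> V" if "x \<in> V" "y \<in> V" for k x y
    using that V by (simp add: subspace_add subspace_scale)
  have expand: "q (x + t *\<^sub>R y) = q x + t * (\<omega> [x, ?S y] + \<omega> [y, ?S x]) + t\<^sup>2 * q y"
    if "x \<in> V" "y \<in> V" for x y t
  proof -
    have "q (t *\<^sub>R y + x) = t * (t * q y + \<omega> [y, ?S x]) + (t * \<omega> [x, ?S y] + q x)"
      using that unfolding q_def by (simp add: S l1 l2 mem sub) (simp add: algebra_simps)
    then show ?thesis by (simp add: algebra_simps power2_eq_square)
  qed
  have q_scale: "q (t *\<^sub>R v) = t\<^sup>2 * q v" if "v \<in> V" for t v
    using that V unfolding q_def
    by (simp add: S_scale s1 s2 mem subspace_scale power2_eq_square)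
  have q_nz: "q v \<noteq> 0" if "v \<in> V" "v \<noteq> 0" for v
    unfolding q_def using S_rho_kernel[OF \<rho> \<Omega> that] that by (intro nz) auto
  show ?thesis
  proof (cases "q a > 0")
    case True
    have pos: "q v > 0" if "v \<in> V" "v \<noteq> 0" for v
      using anisotropic_quadratic_sign[OF V(1) expand q_scale q_nz a(1) that(1) a(2) that(2) True] .
    obtain k where "k > 0" "\<And>v. J_rho V \<Omega> \<rho> v = k *\<^sub>R ?S v"
      using J_rho_positive_multiple[OF \<rho> \<Omega>] by blast
    then have "taming_on V \<omega> (J_rho V \<Omega> \<rho>)"
      using pos unfolding taming_on_def q_def by (simp add: s2 mem)
    then show ?thesis using that \<Omega> by blast
  next
    case False
    have expand': "- q (x + t *\<^sub>R y) = - q x + t * - (\<omega> [x, ?S y] + \<omega> [y, ?S x]) + t\<^sup>2 * - q y"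
      if "x \<in> V" "y \<in> V" for x y t
      using expand[OF that] by (simp add: algebra_simps)
    have "- q a > 0" using False q_nz[OF a] by simp
    then have neg: "- q v > 0" if "v \<in> V" "v \<noteq> 0" for v
      using anisotropic_quadratic_sign[where q = "\<lambda>v. - q v", OF V(1) expand' _ _ a(1) that(1) a(2) that(2)]
        q_scale q_nz by simp
    \<comment> \<open>In the negative case the opposite orientation turns \<open>q\<close> into
      \<open>- q\<close>.\<close>
    let ?\<Omega> = "\<lambda>vs. - \<Omega> vs"
    have \<Omega>': "volume_form6 V ?\<Omega>" using S_rho_uminus(1)[OF \<Omega> f a(1) bl] .
    obtain k where "k > 0" "\<And>v. J_rho V ?\<Omega> \<rho> v = k *\<^sub>R S_rho V ?\<Omega> \<rho> v"
      using J_rho_positive_multiple[OF \<rho> \<Omega>'] by blast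
    moreover have "\<omega> [v, k *\<^sub>R S_rho V ?\<Omega> \<rho> v] = k * - q v" if "v \<in> V" for v
      using s2[OF mem[OF that] that, of "- k"]
      by (simp add: S_rho_uminus(2)[OF \<Omega> f that bl] q_def)
    ultimately have "taming_on V \<omega> (J_rho V ?\<Omega> \<rho>)"
      using neg unfolding taming_on_def by (simp add: mult_pos_neg)
    then show ?thesis using that \<Omega>' by blast
  qed
qed

section \<open>Definite 3-forms in dimension seven and central extensions\<close>

lemma tuples_2E:
  assumes "vs \<in> tuples V 2" obtains x y where "vs = [x, y]" "x \<in> V" "y \<in> V"
  using assms by (auto simp: tuples_def length_Suc_conv numeral_eq_Suc)

lemma tuples_3E:
  assumes "vs \<in> tuples V 3" obtains x y w where "vs = [x, y, w]" "x \<in> V" "y \<in> V" "w \<in> V"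
  using assms by (auto simp: tuples_def length_Suc_conv numeral_eq_Suc)

lemma tuples_4E:
  assumes "vs \<in> tuples V 4"
  obtains x y w t where "vs = [x, y, w, t]" "x \<in> V" "y \<in> V" "w \<in> V" "t \<in> V"
  using assms by (auto simp: tuples_def length_Suc_conv numeral_eq_Suc)

text \<open>Rank six in dimension seven leaves a kernel of dimension one, and alternation puts
  \<open>v\<close> into it.\<close>

lemma definite7_kernel:
  assumes "definite7 V \<phi>" "v \<in> V" "v \<noteq> 0" "x \<in> V" "\<And>y. y \<in> V \<Longrightarrow> \<phi> [v, x, y] = 0"
  shows "x \<in> span {v}"
proof -
  have V: "subspace V" and f: "form_on V 3 \<phi>" and d: "dim V = 7"
    and r: "rank2 V (interior v \<phi>) = 6"
    using assms unfolding definite7_def by auto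
  define K where "K = {x \<in> V. \<forall>y\<in>V. interior v \<phi> [x, y] = 0}"
  have "dim K = Suc 0" using r d unfolding rank2_def K_def by simp
  moreover have K: "subspace K" unfolding K_def using V f assms(2) by (rule subspace_interior_kernel)
  moreover have "v \<in> K" using form_on_repeat_3[OF f] assms(2) by (auto simp: K_def interior_def)
  ultimately obtain ws where ws: "basis_list K ([v] @ ws)" "length ([v] @ ws) = Suc 0"
    using basis_list_extend[OF K, of 0 "[v]"] assms(3) by auto
  then have "span {v} = K" unfolding basis_list_def by simp
  then show ?thesis using assms(4,5) by (simp add: K_def interior_def)
qed

text \<open>The type carries no dimension assumption of its own; the finite basis \<open>B\<close>
  supplies one through the locale of finite-dimensional spaces.\<close>

lemma linear_inj_imp_surj_span:
  fixes T :: "'a::real_vector \<Rightarrow> 'a" and B :: "'a set"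
  assumes "finite B" "independent B" "span B = UNIV" "linear T" "inj T"
  shows "surj T"
proof -
  interpret fd: finite_dimensional_vector_space "scaleR :: real \<Rightarrow> 'a \<Rightarrow> 'a" B
    using assms(1-3) by unfold_locales (auto simp: dependent_raw_def span_raw_def)
  show ?thesis
    using fd.linear_inj_imp_surj[of T] assms(4,5) by (simp add: linear_def)
qed

text \<open>Contraction with \<open>v\<close> embeds the quotient by \<open>v\<close> into the
  functionals vanishing at \<open>v\<close>. Both have dimension six, so every such functional is
  reached.\<close>

lemma definite7_interior_surj:
  fixes \<phi> \<theta> :: "'a::real_vector form"
  assumes \<phi>: "definite7 UNIV \<phi>" and v: "v \<noteq> 0" and \<theta>: "form_on UNIV 1 \<theta>" "\<theta> [v] = 0"
  obtains u where "\<And>y. \<phi> [v, u, y] = \<theta> [y]"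
proof -
  have f: "form_on UNIV 3 \<phi>" and d: "dim (UNIV :: 'a set) = Suc 6"
    using \<phi> unfolding definite7_def by auto
  obtain bs where e: "basis_list UNIV ([v] @ bs)"
    using basis_list_extend[of UNIV 6 "[v]"] d v by auto
  define B where "B = set bs"
  have vB: "v \<notin> B" and fin: "finite B" and ind: "independent (insert v B)"
    and sp: "span (insert v B) = UNIV"
    using e unfolding basis_list_def B_def by auto
  obtain g :: "'a \<Rightarrow> real" where g: "linear g" "g v = 1" "\<And>y. y \<in> insert v B \<Longrightarrow> y \<noteq> v \<Longrightarrow> g y = 0"
    using basis_list_coordinate[OF e, of v] unfolding B_def by auto
  have gB: "g b = 0" if "b \<in> B" for b using g(3)[of b] that vB by auto
  have lin: "\<phi> [v, c *\<^sub>R x + x', b] = c * \<phi> [v, x, b] + \<phi> [v, x', b]" for c x x' b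
    using form_on_linear_3(2)[OF f] by simp
  have zero: "\<phi> [v, 0, b] = 0" for b using lin[of 1 0 0 b] by simp
  have rep: "\<phi> [v, v, b] = 0" "\<phi> [v, b, v] = 0" for b
    using form_on_repeat_3[OF f] by auto
  \<comment> \<open>An endomorphism encoding the contraction: the values on \<open>B\<close> become
    coordinates, and \<open>g x\<close> fills the direction \<open>v\<close>, which the contraction
    kills, so that \<open>T\<close> is injective.\<close>
  define T where "T = (\<lambda>x. (\<Sum>b\<in>B. \<phi> [v, x, b] *\<^sub>R b) + g x *\<^sub>R v)"
  have T: "linear T"
  proof (rule linearI)
    show "T (x + y) = T x + T y" for x y
      using lin[of 1 x y] g(1)
      by (simp add: T_def linear_add scaleR_add_left sum.distrib algebra_simps)
    show "T (c *\<^sub>R x) = c *\<^sub>R T x" for c x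
      using lin[of c x 0] g(1)
      by (simp add: T_def linear_scale zero scaleR_add_right scaleR_sum_right)
  qed
  have coord: "\<exists>h. linear h \<and> h v = 0 \<and> (\<forall>r::'a \<Rightarrow> real. h (\<Sum>b\<in>B. r b *\<^sub>R b) = r c)" if c: "c \<in> B" for c
  proof -
    obtain h :: "'a \<Rightarrow> real" where h: "linear h" "h c = 1" "\<And>y. y \<in> insert v B \<Longrightarrow> y \<noteq> c \<Longrightarrow> h y = 0"
      using basis_list_coordinate[OF e, of c] c unfolding B_def by auto
    have "h (\<Sum>b\<in>B. r b *\<^sub>R b) = (\<Sum>b\<in>B. if b = c then r b else 0)" for r
      unfolding linear_sum[OF h(1)] using h by (intro sum.cong) (auto simp: linear_scale)
    then show ?thesis using h(1) h(3)[of v] c vB fin by (intro exI[of _ h]) auto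
  qed
  \<comment> \<open>The coordinate functional of \<open>c\<close> annihilates \<open>v\<close>, so
    it reads off the contraction from \<open>T x\<close> without the extra term.\<close>
  have Tc: "\<phi> [v, x, c] = r c" if x: "T x = (\<Sum>b\<in>B. r b *\<^sub>R b)" and c: "c \<in> B" for x r c
  proof -
    obtain h where h: "linear h" "h v = 0" "\<And>r::'a \<Rightarrow> real. h (\<Sum>b\<in>B. r b *\<^sub>R b) = r c"
      using coord[OF c] by blast
    have "h (T x) = \<phi> [v, x, c]" using h by (simp add: T_def linear_add linear_scale)
    then show ?thesis using x h by simp
  qed
  have ext: "\<phi> [v, x, y] = \<eta> [y]"
    if \<eta>: "form_on UNIV 1 \<eta>" "\<eta> [v] = 0" "\<And>c. c \<in> B \<Longrightarrow> \<phi> [v, x, c] = \<eta> [c]" for x y \<eta>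
  proof -
    have "form_on UNIV 1 (interior x (interior v \<phi>))"
      using form_on_interior[of UNIV 2 \<phi> v] form_on_interior[of UNIV 1 "interior v \<phi>" x] f
      by (simp add: numeral_eq_Suc)
    then have d: "form_on (span (insert v B)) 1 (\<lambda>vs. interior x (interior v \<phi>) vs - 1 * \<eta> vs)"
      unfolding sp by (rule form_on_diff_scaled[OF _ \<eta>(1)])
    have "interior x (interior v \<phi>) [y] - 1 * \<eta> [y] = 0"
    proof (rule form_on_eq_0_span[OF d])
      fix vs assume "vs \<in> tuples (insert v B) 1"
      then obtain w where "vs = [w]" "w \<in> insert v B"
        by (auto simp: tuples_def length_Suc_conv)
      then show "interior x (interior v \<phi>) vs - 1 * \<eta> vs = 0"
        using \<eta>(2,3) rep by (auto simp: interior_def)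
    qed (use sp in auto)
    then show ?thesis by (simp add: interior_def)
  qed
  have "inj T"
    unfolding linear_injective_0[OF T]
  proof (intro allI impI)
    \<comment> \<open>The coordinates on \<open>B\<close> put \<open>x\<close> into
      \<open>span {v}\<close>, and the \<open>v\<close>-component \<open>g x\<close> excludes a
      nonzero multiple.\<close>
    fix x assume x: "T x = 0"
    then have "\<phi> [v, x, c] = 0" if "c \<in> B" for c using Tc[of x "\<lambda>_. 0"] that by simp
    then have "\<phi> [v, x, y] = 0" for y
      using ext[of "\<lambda>_. 0" x y] by (simp add: form_on_def)
    then have "x \<in> span {v}" using definite7_kernel[OF \<phi> _ v] by simp
    then obtain k where k: "x = k *\<^sub>R v" by (auto simp: span_singleton)
    have "g (T x) = g x"
      using g(1,2) gB unfolding T_def by (simp add: linear_add linear_scale linear_sum)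
    then show "x = 0" using x k g(1,2) by (simp add: linear_scale linear_0)
  qed
  have "surj T" using linear_inj_imp_surj_span[OF _ ind sp T \<open>inj T\<close>] fin by simp
  then have "(\<Sum>b\<in>B. \<theta> [b] *\<^sub>R b) \<in> range T" by blast
  then obtain u where u: "T u = (\<Sum>b\<in>B. \<theta> [b] *\<^sub>R b)" by (elim rangeE) (rule that, rule sym)
  have "\<phi> [v, u, y] = \<theta> [y]" for y
    by (rule ext[OF \<theta>]) (rule Tc[OF u])
  then show ?thesis by (rule that)
qed

lemma form_on_2I:
  assumes "\<And>x y w c. x \<in> V \<Longrightarrow> y \<in> V \<Longrightarrow> w \<in> V \<Longrightarrow> b (c *\<^sub>R x + y) w = c * b x w + b y w"
    and "\<And>x y w c. x \<in> V \<Longrightarrow> y \<in> V \<Longrightarrow> w \<in> V \<Longrightarrow> b w (c *\<^sub>R x + y) = c * b w x + b w y"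
    and "\<And>x. x \<in> V \<Longrightarrow> b x x = 0"
  shows "form_on V 2 (\<lambda>vs. b (vs ! 0) (vs ! 1))"
  unfolding form_on_def
proof safe
  fix us ws x y and c :: real
  assume t: "us @ x # ws \<in> tuples V 2" and y: "y \<in> V"
  from t consider w where "us = []" "ws = [w]" | w where "us = [w]" "ws = []"
    by (cases us; cases ws) auto
  then show "b ((us @ (c *\<^sub>R x + y) # ws) ! 0) ((us @ (c *\<^sub>R x + y) # ws) ! 1) =
      c * b ((us @ x # ws) ! 0) ((us @ x # ws) ! 1) + b ((us @ y # ws) ! 0) ((us @ y # ws) ! 1)"
  proof cases
    case (1 w)
    then show ?thesis using t y assms(1)[of x y w c] by simp
  next
    case (2 w)
    then show ?thesis using t y assms(2)[of x y w c] by simp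
  qed
next
  fix vs assume vs: "vs \<in> tuples V 2" "\<not> distinct vs"
  from vs(1) obtain x y where "vs = [x, y]" "x \<in> V" by (rule tuples_2E)
  then show "b (vs ! 0) (vs ! 1) = 0" using vs(2) assms(3)[of x] by simp
qed

section \<open>Splitting along a central vector\<close>

theorem proposition3p2:
  fixes br :: "'a::real_vector \<Rightarrow> 'a \<Rightarrow> 'a"
    and \<phi> \<theta> :: "'a form"
    and z :: 'a
  assumes "dim (UNIV :: 'a set) = 7"
    and "lie_algebra_on UNIV br"
    and "closed_G2_structure UNIV br \<phi>"
    and "z \<in> lie_center UNIV br" and "z \<noteq> 0"
    and "form_on UNIV 1 \<theta>" and "\<theta> [z] = 1"
  shows "\<exists>(H :: 'a set) brH \<omega>0 \<omega> \<rho>.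
           lie_algebra_on H brH \<and> dim H = 6 \<and>
           closed_form_on H brH 2 \<omega>0 \<and>
           central_extension br H brH \<omega>0 z \<and>
           (\<forall>x\<in>H. \<theta> [x] = 0) \<and>
           form_eq UNIV 3 \<phi>
             (\<lambda>vs. wedge 2 (extend_form \<theta> z \<omega>) \<theta> vs + extend_form \<theta> z \<rho> vs) \<and>
           definite6 H \<rho> \<and>
           symplectic_on H brH \<omega> \<and>
           (\<exists>\<Omega>. volume_form6 H \<Omega> \<and> taming_on H \<omega> (J_rho H \<Omega> \<rho>)) \<and>
           form_eq H 4 (ce_d brH \<rho>) (\<lambda>vs. - wedge 2 \<omega> \<omega>0 vs)"
proof -
  note [simp] = form_on_1_linear[OF assms(6) subspace_UNIV UNIV_I UNIV_I] assms(7)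
  have \<theta>0 [simp]: "\<theta> [0] = 0" using form_on_1_linear(2)[OF assms(6), of 0 0 0] by simp
  have \<phi>: "definite7 UNIV \<phi>" and f: "form_on UNIV 3 \<phi>"
    and d\<phi>: "\<And>vs. vs \<in> tuples UNIV 4 \<Longrightarrow> ce_d br \<phi> vs = 0"
    using assms(3) unfolding closed_G2_structure_def definite7_def closed_form_on_def form_eq_def
    by (auto simp: eval_nat_numeral)
  note lin = form_on_linear_3[OF f UNIV_I UNIV_I UNIV_I UNIV_I]
  note rep [simp] = form_on_repeat_3[OF f UNIV_I UNIV_I]
  note swap = form_on_swap_3[OF subspace_UNIV f UNIV_I UNIV_I UNIV_I]
  have \<phi>0 [simp]: "\<phi> [0, x, y] = 0" "\<phi> [x, 0, y] = 0" "\<phi> [x, y, 0] = 0" for x y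
    using lin(1)[of 1 0 0 x y] lin(2)[of x 1 0 0 y] lin(3)[of x y 1 0 0] by simp_all
  have sub: "\<phi> [x - c *\<^sub>R z, y, w] = \<phi> [x, y, w] - c * \<phi> [z, y, w]"
    "\<phi> [y, x - c *\<^sub>R z, w] = \<phi> [y, x, w] - c * \<phi> [y, z, w]"
    "\<phi> [y, w, x - c *\<^sub>R z] = \<phi> [y, w, x] - c * \<phi> [y, w, z]" for x y w c
    using lin(1)[of "- c" z x y w] lin(2)[of y "- c" z x w] lin(3)[of y w "- c" z x] by simp_all
  have zswap: "\<phi> [x, z, y] = - \<phi> [z, x, y]" "\<phi> [x, y, z] = \<phi> [z, x, y]" for x y
    using swap(1)[of x z y] swap(2)[of x y z] by simp_all

  have br1: "br (c *\<^sub>R x + x') y = c *\<^sub>R br x y + br x' y"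
    and br2: "br y (c *\<^sub>R x + x') = c *\<^sub>R br y x + br y x'"
    and br_self [simp]: "br x x = 0"
    and jacobi: "br x (br y w) + br y (br w x) + br w (br x y) = 0" for c x x' y w
    using assms(2) unfolding lie_algebra_on_def by auto
  have br_skew: "br x y = - br y x" for x y
    using br_self[of "x + y"] br1[of 1 x y "x + y"] br2[of x 1 x y] br2[of y 1 x y]
    by (simp add: eq_neg_iff_add_eq_0)
  have br_z [simp]: "br z x = 0" "br x z = 0" for x
    using assms(4) br_skew[of x z] unfolding lie_center_def by auto
  \<comment> \<open>Changing an argument by a multiple of \<open>z\<close> does not affect the
    bracket, so iterated brackets in \<open>brH\<close> differ from those in \<open>br\<close> only
    by multiples of \<open>z\<close>.\<close>
  have br_sub [simp]: "br (x - c *\<^sub>R z) y = br x y" "br y (x - c *\<^sub>R z) = br y x" for x y c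
    using br1[of "- c" z x y] br2[of y "- c" z x] by simp_all

  define H where "H = {x. \<theta> [x] = 0}"
  define brH where "brH = (\<lambda>x y. br x y - \<theta> [br x y] *\<^sub>R z)"
  \<comment> \<open>This is the differential of \<open>\<theta>\<close>; the sign matches
    \<open>br x y = - \<omega>0 [x, y] *\<^sub>R z + brH x y\<close>.\<close>
  define \<omega>0 where "\<omega>0 = (\<lambda>vs. - \<theta> [br (vs ! 0) (vs ! 1)])"
  define \<omega> where "\<omega> = interior z \<phi>"

  have H: "subspace H" unfolding H_def subspace_def by simp
  have zH: "z \<notin> H" by (simp add: H_def)
  have proj: "x - \<theta> [x] *\<^sub>R z \<in> H" for x by (simp add: H_def)
  have spH: "span (insert z H) = UNIV"
  proof -
    have "(x - \<theta> [x] *\<^sub>R z) + \<theta> [x] *\<^sub>R z \<in> span (insert z H)" for x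
      using proj by (intro span_add span_scale span_base) auto
    then show ?thesis by auto
  qed
  have dimH: "dim H = 6"
  proof -
    obtain B where B: "B \<subseteq> H" "independent B" "H \<subseteq> span B" "card B = dim H"
      using basis_exists by blast
    have spB: "span B = H" using B H by (simp add: span_subspace)
    then have ind: "independent (insert z B)" using zH B by (simp add: independent_insert)
    have "insert z H \<subseteq> span (insert z B)"
      using B(3) span_mono[of B "insert z B"] span_base[of z "insert z B"] by auto
    then have "span (insert z B) = UNIV" using spH span_minimal[of "insert z H"] by auto
    then have c: "card (insert z B) = 7"
      using dim_span_eq_card_independent[OF ind] assms(1) by simp
    then have "finite B" using card_ge_0_finite[of "insert z B"] by simp
    moreover have "z \<notin> B" using B(1) zH by blast
    ultimately show ?thesis using c B(4) by simp
  qed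
  \<comment> \<open>Extends vanishing known for third arguments in \<open>H\<close> and at
    \<open>z\<close> to all third arguments.\<close>
  have decomp: "\<phi> [v, u, y] = \<phi> [v, u, y - \<theta> [y] *\<^sub>R z] + \<theta> [y] * \<phi> [v, u, z]" for v u y
    by (simp add: sub)

  have lieH: "lie_algebra_on H brH"
    unfolding lie_algebra_on_def
  proof (intro conjI ballI allI H)
    fix x x' y w c
    show "brH x y \<in> H" unfolding brH_def by (rule proj)
    show "brH (c *\<^sub>R x + x') y = c *\<^sub>R brH x y + brH x' y"
      by (simp add: brH_def br1) (simp add: algebra_simps)
    show "brH y (c *\<^sub>R x + x') = c *\<^sub>R brH y x + brH y x'"
      by (simp add: brH_def br2) (simp add: algebra_simps)
    show "brH x x = 0" by (simp add: brH_def)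
    have "\<theta> [br x (br y w)] + \<theta> [br y (br w x)] + \<theta> [br w (br x y)] = 0"
      using arg_cong[OF jacobi[of x y w], of "\<lambda>v. \<theta> [v]"] by simp
    moreover have "brH x (brH y w) + brH y (brH w x) + brH w (brH x y) =
        (br x (br y w) + br y (br w x) + br w (br x y))
        - (\<theta> [br x (br y w)] + \<theta> [br y (br w x)] + \<theta> [br w (br x y)]) *\<^sub>R z"
      by (simp add: brH_def algebra_simps)
    ultimately show "brH x (brH y w) + brH y (brH w x) + brH w (brH x y) = 0"
      using jacobi[of x y w] by simp
  qed

  have \<omega>0_form: "form_on H 2 \<omega>0"
    unfolding \<omega>0_def by (rule form_on_2I) (simp_all add: br1 br2)
  have closed_\<omega>0: "closed_form_on H brH 2 \<omega>0"
    unfolding closed_form_on_def form_eq_def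
  proof (intro conjI ballI \<omega>0_form)
    fix vs assume "vs \<in> tuples H (Suc 2)"
    then have "vs \<in> tuples H 3" by simp
    then obtain x y w where vs: "vs = [x, y, w]" by (rule tuples_3E)
    \<comment> \<open>Closedness of \<open>\<omega>0\<close> is the \<open>z\<close>-component of
      the Jacobi identity.\<close>
    have "\<theta> [br x (br y w)] + \<theta> [br y (br w x)] + \<theta> [br w (br x y)] = 0"
      using arg_cong[OF jacobi[of x y w], of "\<lambda>v. \<theta> [v]"] by simp
    moreover have neg: "\<theta> [- v] = - \<theta> [v]" for v
      using form_on_1_linear(2)[OF assms(6), of v v "-1"] by simp
    moreover have "br y (br w x) = - br y (br x w)"
      using br2[of y "-1" "br x w" 0] br2[of y 1 0 0] br_skew[of w x] by simp
    ultimately show "ce_d brH \<omega>0 vs = 0"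
      using br_skew[of "br x y" w] br_skew[of "br x w" y] br_skew[of "br y w" x]
      by (simp add: vs ce_d_3 \<omega>0_def brH_def)
  qed

  have ext: "central_extension br H brH \<omega>0 z"
    unfolding central_extension_def
    using assms(2) lieH closed_\<omega>0 zH spH by (simp add: \<omega>0_def brH_def)

  \<comment> \<open>\<open>\<phi>\<close> itself serves as \<open>\<rho>\<close>, since only values
    on \<open>H\<close> count. Splitting each argument along \<open>H\<close> and \<open>z\<close>,
    terms with \<open>z\<close> twice vanish and those with \<open>z\<close> once form the wedge
    product.\<close>
  have \<phi>_eq: "form_eq UNIV 3 \<phi> (\<lambda>vs. wedge 2 (extend_form \<theta> z \<omega>) \<theta> vs + extend_form \<theta> z \<phi> vs)"
    unfolding form_eq_def
  proof
    fix vs :: "'a list" assume "vs \<in> tuples UNIV 3"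
    then obtain x y w where vs: "vs = [x, y, w]" by (rule tuples_3E)
    show "\<phi> vs = wedge 2 (extend_form \<theta> z \<omega>) \<theta> vs + extend_form \<theta> z \<phi> vs"
      by (simp add: vs wedge_2_3 extend_form_def \<omega>_def interior_def sub zswap algebra_simps)
  qed

  have fH: "form_on H 3 \<phi>" using form_on_subset[OF f] by simp
  have \<rho>: "definite6 H \<phi>"
    unfolding definite6_def
  proof (intro conjI H dimH fH ballI impI)
    fix v assume v: "v \<in> H" "v \<noteq> 0"
    \<comment> \<open>\<open>\<theta>\<close> vanishes at \<open>v\<close> because \<open>v\<close>
      lies in \<open>H\<close>, so it is a contraction; its value 1 at \<open>z\<close> will show
      that \<open>u\<close> is no multiple of \<open>v\<close>.\<close>
    obtain u where u: "\<And>y. \<phi> [v, u, y] = \<theta> [y]"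
      using definite7_interior_surj[OF \<phi> v(2) assms(6)] v by (auto simp: H_def)
    have uH: "u \<in> H" using u[of u] by (simp add: H_def)
    have "u \<notin> span {v}"
    proof
      assume "u \<in> span {v}"
      then obtain k where "u = k *\<^sub>R v" by (auto simp: span_singleton)
      then show False using u[of z] lin(2)[of v k v 0 z] by simp
    qed
    then have ind: "independent {u, v}" "u \<noteq> v"
      using v by (auto simp: independent_insert span_base)
    let ?K = "{x \<in> H. \<forall>y\<in>H. interior v \<phi> [x, y] = 0}"
    have "?K = span {u, v}"
    proof
      have "{u, v} \<subseteq> ?K" using v uH u by (auto simp: interior_def H_def)
      then show "span {u, v} \<subseteq> ?K"
        using span_minimal subspace_interior_kernel[OF H fH v(1)] by blast
      show "?K \<subseteq> span {u, v}"
      proof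
        fix x assume x: "x \<in> ?K"
        \<comment> \<open>Since \<open>\<phi> [v, u, z] = 1\<close>, subtracting this multiple of
          \<open>u\<close> cancels the value at \<open>z\<close> and leaves an element of the kernel
          of \<open>interior v \<phi>\<close> on the whole space.\<close>
        let ?c = "\<phi> [v, x, z]"
        have eq: "\<phi> [v, x - ?c *\<^sub>R u, y] = \<phi> [v, x, y] - ?c * \<theta> [y]" for y
          using lin(2)[of v "- ?c" u x y] u by simp
        have "\<phi> [v, x - ?c *\<^sub>R u, y] = 0" for y
          using x proj[of y] unfolding eq decomp[of v x y] by (simp add: interior_def)
        then have "x - ?c *\<^sub>R u \<in> span {v}" using definite7_kernel[OF \<phi> _ v(2)] by simp
        then have "x - ?c *\<^sub>R u \<in> span {u, v}" using span_mono[of "{v}" "{u, v}"] by auto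
        then have "(x - ?c *\<^sub>R u) + ?c *\<^sub>R u \<in> span {u, v}"
          by (rule span_add) (intro span_scale span_base, simp)
        then show "x \<in> span {u, v}" by simp
      qed
    qed
    then show "rank2 H (interior v \<phi>) = 4"
      using dim_span_eq_card_independent[OF ind(1)] ind(2) dimH unfolding rank2_def by simp
  qed

  have \<omega>_form: "form_on H 2 \<omega>"
    unfolding \<omega>_def using form_on_subset[OF form_on_interior[of UNIV 2 \<phi> z]] f by simp
  have sympl: "symplectic_on H brH \<omega>"
    unfolding symplectic_on_def closed_form_on_def form_eq_def nondegenerate_on_def
  proof (intro conjI ballI impI \<omega>_form)
    fix vs assume "vs \<in> tuples H (Suc 2)"
    then have "vs \<in> tuples H 3" by simp
    then obtain x y w where vs: "vs = [x, y, w]" by (rule tuples_3E)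
    \<comment> \<open>Brackets with \<open>z\<close> vanish, so the differential of
      \<open>\<phi>\<close> on \<open>[z, x, y, w]\<close> is minus that of \<open>\<omega>\<close>
      on \<open>[x, y, w]\<close>; the \<open>z\<close>-parts of the brackets drop out by
      alternation.\<close>
    show "ce_d brH \<omega> vs = 0"
      using d\<phi>[of "[z, x, y, w]"]
      by (simp add: vs ce_d_3 ce_d_4 \<omega>_def interior_def brH_def sub zswap)
  next
    fix v assume v: "v \<in> H" "v \<noteq> 0"
    show "\<exists>w\<in>H. \<omega> [v, w] \<noteq> 0"
    proof (rule ccontr)
      assume "\<not> (\<exists>w\<in>H. \<omega> [v, w] \<noteq> 0)"
      \<comment> \<open>Such a \<open>v\<close> lies in the kernel of
        \<open>interior z \<phi>\<close>, the line spanned by \<open>z\<close>, which meets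
        \<open>H\<close> only in 0.\<close>
      then have "\<phi> [z, v, y] = 0" for y
        using proj[of y] decomp[of z v y] by (simp add: \<omega>_def interior_def)
      then have "v \<in> span {z}" using definite7_kernel[OF \<phi> _ assms(5)] by simp
      then obtain k where k: "v = k *\<^sub>R z" by (auto simp: span_singleton)
      then have "k = 0" using v(1) form_on_1_linear(2)[OF assms(6), of z z k] by (simp add: H_def)
      then show False using v k by simp
    qed
  qed

  have "\<omega> [v, u] \<noteq> 0"
    if v: "v \<in> H" "v \<noteq> 0" and u: "u \<notin> span {v}" "\<And>y. y \<in> H \<Longrightarrow> \<phi> [v, u, y] = 0" for v u
  proof
    assume "\<omega> [v, u] = 0"
    then have "\<phi> [v, u, z] = 0" by (simp add: zswap \<omega>_def interior_def)
    then have "\<phi> [v, u, y] = 0" for y using u(2)[OF proj] decomp[of v u y] by simp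
    then show False using definite7_kernel[OF \<phi> _ v(2)] u(1) by simp
  qed
  then have tame: "\<exists>\<Omega>. volume_form6 H \<Omega> \<and> taming_on H \<omega> (J_rho H \<Omega> \<phi>)"
    by (metis exists_taming_orientation[OF \<rho> \<omega>_form])

  have d\<rho>: "form_eq H 4 (ce_d brH \<phi>) (\<lambda>vs. - wedge 2 \<omega> \<omega>0 vs)"
    unfolding form_eq_def
  proof
    fix vs assume "vs \<in> tuples H 4"
    then obtain x y w t where vs: "vs = [x, y, w, t]" by (rule tuples_4E)
    \<comment> \<open>Inserting \<open>br x y = brH x y - \<omega>0 [x, y] *\<^sub>R z\<close> into
      the closedness of \<open>\<phi>\<close>, the terms with \<open>z\<close> add up to
      \<open>wedge 2 \<omega> \<omega>0\<close>.\<close>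
    show "ce_d brH \<phi> vs = - wedge 2 \<omega> \<omega>0 vs"
      using d\<phi>[of vs]
      by (simp add: vs ce_d_4 wedge_2_4 \<omega>_def \<omega>0_def interior_def brH_def sub algebra_simps)
  qed
  have \<theta>H: "\<forall>x\<in>H. \<theta> [x] = 0" by (simp add: H_def)
  show ?thesis
    by (rule exI[of _ H], rule exI[of _ brH], rule exI[of _ \<omega>0], rule exI[of _ \<omega>], rule exI[of _ \<phi>])
      (intro conjI lieH dimH closed_\<omega>0 ext \<theta>H \<phi>_eq \<rho> sympl tame d\<rho>)
qed

end
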